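(* Let $n\ge1$, $k\ge1$, let $F:\mathbb{R}^n\times\mathbb{R}\times\mathbb{R}^n\times\mathbb{S}^n\to\mathbb{R}$ be degenerate elliptic and satisfy, for all $x,p\in\mathbb{R}^n$, $X\in\mathbb{S}^n$, $$-F(x,0,p,X)\le C(|x|)\,|p|^k+\Lambda(x_n)\,\mathrm{Tr}(X^+)-\lambda(x_n)\,\mathrm{Tr}(X^-),$$ where $C,\lambda,\Lambda:[0,\infty)\to(0,\infty)$, $C$ is continuous and nonincreasing, $\lambda$ is nonincreasing and $\Lambda$ is nondecreasing. Put $A(t)=C(t)/\lambda(t)$ and let $\gamma:(0,\infty)\to(0,\infty)$ be nondecreasing with $$\frac{\Lambda(R)}{C(R)}\int_0^RA(s)\,ds\precsim\gamma(R).$$ For $\nu>0$ let $$f_\nu(t)=\nu e^{-\int_0^tA(s)ds}\ \text{ if }k=1,\qquad f_\nu(t)=\left((k-1)\int_0^tA(s)\,ds+\nu^{1-k}\right)^{\frac1{1-k}}\ \text{ if }k>1.$$ Let $u$ be a viscosity subsolution of $F(x,u,Du,D^2u)=0$ in $\mathbb{R}^n_+$ satisfying $\limsup_{x\to y}u(x)\le0$ for all $y\in\partial\mathbb{R}^n_+$, and suppose that $\nu>0$ is such that $u(\bar x)\ge\int_0^{\bar x_n}f_\nu(t)\,dt$ for some $\bar x\in\mathbb{R}^n_+$ on the $x_n$-axis. Then $$\liminf_{R\to\infty}\frac{M'(R)}{f_\nu(R)}>0.$$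
   Context: Notation: $\mathbb{R}^n_+=\{x\in\mathbb{R}^n:x_n>0\}$; $\mathbb{S}^n$ is the set of symmetric $n\times n$ matrices with the positive semidefinite ordering. For $X\in\mathbb{S}^n$ write $X=X^+-X^-$ with $X^\pm\ge0$, $X^+X^-=0$. Degenerate ellipticity: $F(x,u,p,X)\ge F(x,v,p,Y)$ whenever $u\ge v$ and $X\le Y$. Viscosity subsolution in a domain $\Omega$: an upper semicontinuous $u:\Omega\to\mathbb{R}$ such that whenever $\varphi\in C^2(\Omega)$ and $u-\varphi$ has a local maximum at $x_0\in\Omega$, then $F(x_0,u(x_0),D\varphi(x_0),D^2\varphi(x_0))\le0$. $D(R)=\{x\in\mathbb{R}^n_+:\sum_{i=1}^{n-1}x_i^2+(x_n+\gamma(R))^2<(R+\gamma(R))^2\}$, $M(R)=\sup_{\partial D(R)}u$ (with $u(y):=\limsup_{x\to y}u(x)$ for $y\in\partial\mathbb{R}^n_+$), $M'(R)=\liminf_{h\to0^+}\frac{M(R)-M(R-h)}{h}$. $A\precsim B$ means that there is a constant $c>0$ with $A\le cB$. *)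

theory Defs
  imports "HOL-Analysis.Analysis"
begin

text \<open>
  Points of \<open>n\<close>-space are \<open>real^'n\<close>, so \<open>n = CARD('n) \<ge> 1\<close>. The index type carries no order; the
  index \<open>N :: 'n\<close> of the distinguished ("\<open>n\<close>-th") coordinate is an explicit parameter.
\<close>

definition half_space :: "'n::finite \<Rightarrow> (real^'n) set" where
  "half_space N = {x. x $ N > 0}"

definition sym_mat :: "real^'n^'n \<Rightarrow> bool" where
  "sym_mat X \<longleftrightarrow> transpose X = X"

definition psd :: "real^'n^'n \<Rightarrow> bool" where
  "psd X \<longleftrightarrow> sym_mat X \<and> (\<forall>v. 0 \<le> v \<bullet> (X *v v))"

text \<open>
  The semidefinite ordering on symmetric matrices. It is not the library's \<open>\<le>\<close> on
  \<open>real^'n^'n\<close>, which is componentwise.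
\<close>

definition loewner_le :: "real^'n^'n \<Rightarrow> real^'n^'n \<Rightarrow> bool" where
  "loewner_le X Y \<longleftrightarrow> psd (Y - X)"

text \<open>
  \<open>P = X\<^sup>+\<close> and \<open>Q = X\<^sup>-\<close>. Every symmetric \<open>X\<close> has exactly one such pair \<open>P\<close>, \<open>Q\<close>.
\<close>

definition pos_neg_parts :: "real^'n^'n \<Rightarrow> real^'n^'n \<Rightarrow> real^'n^'n \<Rightarrow> bool" where
  "pos_neg_parts X P Q \<longleftrightarrow> X = P - Q \<and> psd P \<and> psd Q \<and> P ** Q = 0"

text \<open>
  Nonlinearities \<open>F(x,u,p,X)\<close> are total in \<open>X\<close>, but only their values at symmetric matrices matter.
\<close>

definition degenerate_elliptic ::
  "(real^'n \<Rightarrow> real \<Rightarrow> real^'n \<Rightarrow> real^'n^'n \<Rightarrow> real) \<Rightarrow> bool" where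
  "degenerate_elliptic F \<longleftrightarrow>
     (\<forall>x u v p X Y. sym_mat X \<longrightarrow> sym_mat Y \<longrightarrow> u \<ge> v \<longrightarrow> loewner_le X Y
        \<longrightarrow> F x u p X \<ge> F x v p Y)"

definition grad :: "(real^'n \<Rightarrow> real) \<Rightarrow> real^'n \<Rightarrow> real^'n" where
  "grad \<phi> x = (\<chi> i. frechet_derivative \<phi> (at x) (axis i 1))"

definition hessian :: "(real^'n \<Rightarrow> real) \<Rightarrow> real^'n \<Rightarrow> real^'n^'n" where
  "hessian \<phi> x = jacobian (grad \<phi>) (at x)"

text \<open>Intended for open \<open>\<Omega>\<close>.\<close>

definition C2_on :: "(real^'n) set \<Rightarrow> (real^'n \<Rightarrow> real) \<Rightarrow> bool" where
  "C2_on \<Omega> \<phi> \<longleftrightarrow>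
     \<phi> differentiable_on \<Omega> \<and> grad \<phi> differentiable_on \<Omega> \<and> continuous_on \<Omega> (hessian \<phi>)"

definition usc_on :: "'a::topological_space set \<Rightarrow> ('a \<Rightarrow> real) \<Rightarrow> bool" where
  "usc_on \<Omega> u \<longleftrightarrow> (\<forall>x\<in>\<Omega>. \<forall>a>u x. eventually (\<lambda>y. u y < a) (at x within \<Omega>))"

definition viscosity_subsolution ::
  "(real^'n \<Rightarrow> real \<Rightarrow> real^'n \<Rightarrow> real^'n^'n \<Rightarrow> real) \<Rightarrow> (real^'n) set \<Rightarrow> (real^'n \<Rightarrow> real) \<Rightarrow> bool" where
  "viscosity_subsolution F \<Omega> u \<longleftrightarrow>
     usc_on \<Omega> u \<and>
     (\<forall>\<phi> x0. C2_on \<Omega> \<phi> \<longrightarrow> x0 \<in> \<Omega> \<longrightarrow>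
        (\<exists>e>0. \<forall>x\<in>\<Omega>. dist x x0 < e \<longrightarrow> u x - \<phi> x \<le> u x0 - \<phi> x0) \<longrightarrow>
        F x0 (u x0) (grad \<phi> x0) (hessian \<phi> x0) \<le> 0)"

definition D_region :: "'n::finite \<Rightarrow> (real \<Rightarrow> real) \<Rightarrow> real \<Rightarrow> (real^'n) set" where
  "D_region N \<gamma> R =
     {x \<in> half_space N. (\<Sum>i\<in>UNIV - {N}. (x $ i)\<^sup>2) + (x $ N + \<gamma> R)\<^sup>2 < (R + \<gamma> R)\<^sup>2}"

text \<open>Values are extended reals because the upper limit at a boundary point may be infinite.\<close>

definition upper_ext :: "'a::topological_space set \<Rightarrow> ('a \<Rightarrow> real) \<Rightarrow> 'a \<Rightarrow> ereal" where
  "upper_ext \<Omega> u y =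
     (if y \<in> \<Omega> then ereal (u y) else Limsup (at y within \<Omega>) (\<lambda>x. ereal (u x)))"

definition M_sup :: "'n::finite \<Rightarrow> (real \<Rightarrow> real) \<Rightarrow> (real^'n \<Rightarrow> real) \<Rightarrow> real \<Rightarrow> ereal" where
  "M_sup N \<gamma> u R = (SUP y\<in>frontier (D_region N \<gamma> R). upper_ext (half_space N) u y)"

text \<open>
  For a subsolution with nonpositive boundary values \<open>M_sup\<close> is finite at every \<open>R > 0\<close>, but the
  lower derivative can be infinite, for example where \<open>\<gamma>\<close> jumps.
\<close>

definition M_lower_deriv :: "'n::finite \<Rightarrow> (real \<Rightarrow> real) \<Rightarrow> (real^'n \<Rightarrow> real) \<Rightarrow> real \<Rightarrow> ereal" where
  "M_lower_deriv N \<gamma> u R =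
     Liminf (at_right 0) (\<lambda>h. (M_sup N \<gamma> u R - M_sup N \<gamma> u (R - h)) / ereal h)"

definition f_nu :: "real \<Rightarrow> (real \<Rightarrow> real) \<Rightarrow> real \<Rightarrow> real \<Rightarrow> real" where
  "f_nu k A \<nu> t =
     (if k = 1 then \<nu> * exp (- integral {0..t} A)
      else ((k - 1) * integral {0..t} A + \<nu> powr (1 - k)) powr (1 / (1 - k)))"

end

theory Submission
  imports Defs
begin

text \<open>
  Fix \<open>R\<close> and measure points of \<open>D(R)\<close> by \<open>s = |x + \<gamma>(R) e\<^sub>n| - \<gamma>(R)\<close>, so that \<open>x\<^sub>n \<le> s \<le> |x|\<close>
  and \<open>s = R\<close> on the spherical part of \<open>\<partial>D(R)\<close>. If \<open>B \<ge> A\<close> is continuous and \<open>G\<close> is \<open>f\<^sub>\<nu>\<close> (formed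
  with \<open>B\<close>) times \<open>exp (- \<kappa> \<integral>\<^sub>0\<^sup>s B)\<close>, then \<open>W(s) = \<integral>\<^sub>0\<^sup>s G\<close> has \<open>W'' \<le> - B W'\<^sup>k - \<kappa> B W'\<close>. For
  \<open>\<kappa> = n c / \<integral>\<^sub>0\<^sup>R A\<close> the linear term absorbs the curvature term \<open>(n-1) \<Lambda>(R) W' / \<gamma>(R)\<close>, so every
  \<open>m + W(s)\<close> is a strict classical supersolution in \<open>D(R)\<close>.
  Comparison with \<open>W(s)\<close> at \<open>xbar\<close> forces \<open>M(R) \<ge> W(R)\<close>, because \<open>G < f\<^sub>\<nu>\<close>. Comparison with
  \<open>m = M(R) - W(R) \<ge> 0\<close> gives \<open>M(R) - M(R-h) \<ge> W(R) - W(R-h) \<ge> h G(R)\<close>. Finally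
  \<open>\<kappa> \<integral>\<^sub>0\<^sup>R B\<close> is bounded independently of \<open>R\<close> once \<open>\<integral>\<^sub>0\<^sup>R B \<le> 2 \<integral>\<^sub>0\<^sup>R A\<close>, whence \<open>G(R)\<close> dominates a
  fixed multiple of \<open>f\<^sub>\<nu>(R)\<close>.
\<close>

subsection \<open>Upper semicontinuity and comparison\<close>

text \<open>Otherwise each \<open>x\<close> in \<open>K\<close> has some \<open>h x\<close> in
  \<open>K\<close> with a larger value, and \<open>f < f (h x)\<close> near \<open>x\<close>. In a
  finite subcover take the centre \<open>t\<close> with the largest \<open>f (h t)\<close>: the
  point \<open>h t\<close> is itself covered, by some \<open>U s\<close>, so
  \<open>f (h t) < f (h s)\<close>, a contradiction.\<close>

lemma usc_on_compact_attains_max: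
  assumes "compact K" "K \<noteq> {}" and usc: "usc_on K f"
  obtains x where "x \<in> K" "\<And>y. y \<in> K \<Longrightarrow> f y \<le> f x"
proof (rule ccontr)
  assume "\<not> thesis"
  with that have "\<forall>x\<in>K. \<exists>y\<in>K. f x < f y"
    by (meson not_le)
  then obtain h where h: "\<And>x. x \<in> K \<Longrightarrow> h x \<in> K \<and> f x < f (h x)"
    by metis
  have "\<exists>U. open U \<and> x \<in> U \<and> (\<forall>y\<in>U \<inter> K. f y < f (h x))" if "x \<in> K" for x
  proof -
    have "eventually (\<lambda>y. f y < f (h x)) (at x within K)"
      using usc h[OF that] that unfolding usc_on_def by blast
    then obtain U where "open U" "x \<in> U" "\<forall>y\<in>U. y \<noteq> x \<longrightarrow> y \<in> K \<longrightarrow> f y < f (h x)"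
      unfolding eventually_at_topological by blast
    moreover from this(3) have "\<forall>y\<in>U \<inter> K. f y < f (h x)"
      using h[OF that] by (metis IntE)
    ultimately show ?thesis
      by blast
  qed
  then have "\<forall>x\<in>K. \<exists>U. open U \<and> x \<in> U \<and> (\<forall>y\<in>U \<inter> K. f y < f (h x))"
    by blast
  from bchoice[OF this] obtain U
    where "\<forall>x\<in>K. open (U x) \<and> x \<in> U x \<and> (\<forall>y\<in>U x \<inter> K. f y < f (h x))"
    by (elim exE)
  then have U: "open (U x) \<and> x \<in> U x \<and> (\<forall>y\<in>U x \<inter> K. f y < f (h x))" if "x \<in> K" for x
    using that by (rule bspec)
  have "open (U x)" if "x \<in> K" for x
    using U[OF that] by simp
  moreover have "K \<subseteq> (\<Union>x\<in>K. U x)"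
    using U by auto
  ultimately obtain T where T: "T \<subseteq> K" "finite T" "K \<subseteq> (\<Union>x\<in>T. U x)"
    by (rule compactE_image[OF \<open>compact K\<close>])
  then have "T \<noteq> {}"
    using \<open>K \<noteq> {}\<close> by auto
  define m where "m = Max ((\<lambda>x. f (h x)) ` T)"
  have "m \<in> (\<lambda>x. f (h x)) ` T"
    unfolding m_def using T \<open>T \<noteq> {}\<close> by (intro Max_in) auto
  then obtain t where t: "t \<in> T" "m = f (h t)"
    by auto
  then have "h t \<in> K"
    using T h by blast
  then obtain s where s: "s \<in> T" "h t \<in> U s"
    using T by blast
  then have "f (h t) < f (h s)"
    using U[of s] T \<open>h t \<in> K\<close> by auto
  also have "\<dots> \<le> m"
    unfolding m_def using T s by (intro Max_ge) auto
  finally show False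
    using t by simp
qed

text \<open>Truncation at \<open>0\<close> turns the boundary condition, a bound on upper limits
  only, into upper semicontinuity up to the boundary of \<open>\<Omega>\<close>.\<close>

definition pos_ext :: "'a set \<Rightarrow> ('a \<Rightarrow> real) \<Rightarrow> 'a \<Rightarrow> real" where
  "pos_ext \<Omega> u x = (if x \<in> \<Omega> then max (u x) 0 else 0)"

lemma usc_on_pos_ext_minus:
  fixes u w :: "'a::topological_space \<Rightarrow> real"
  assumes usc: "usc_on \<Omega> u" and "open \<Omega>"
    and bdry: "\<And>y. y \<in> frontier \<Omega> \<Longrightarrow> Limsup (at y within \<Omega>) (\<lambda>x. ereal (u x)) \<le> 0"
    and K: "K \<subseteq> closure \<Omega>" and w: "continuous_on K w"
  shows "usc_on K (\<lambda>x. pos_ext \<Omega> u x - w x)"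
  unfolding usc_on_def
proof (intro ballI allI impI)
  fix y a assume y: "y \<in> K" and a: "pos_ext \<Omega> u y - w y < a"
  define e where "e = (a - (pos_ext \<Omega> u y - w y)) / 2"
  have "e > 0"
    using a by (simp add: e_def)
  have nonneg: "pos_ext \<Omega> u y \<ge> 0"
    by (simp add: pos_ext_def)
  have "\<forall>\<^sub>F x in at y within \<Omega>. u x < pos_ext \<Omega> u y + e"
  proof (cases "y \<in> \<Omega>")
    case True
    then have "u y < pos_ext \<Omega> u y + e"
      using \<open>e > 0\<close> by (simp add: pos_ext_def)
    then show ?thesis
      using usc True unfolding usc_on_def by blast
  next
    case False
    then have "y \<in> frontier \<Omega>"
      using y K \<open>open \<Omega>\<close> by (auto simp: frontier_def interior_open)
    then have "Limsup (at y within \<Omega>) (\<lambda>x. ereal (u x)) \<le> 0"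
      by (rule bdry)
    also have "0 < ereal (pos_ext \<Omega> u y + e)"
      using nonneg \<open>e > 0\<close> by simp
    finally show ?thesis
      by (auto dest: Limsup_lessD)
  qed
  \<comment> \<open>Outside \<open>\<Omega>\<close> the extension is \<open>0\<close>, which is
    below \<open>pos_ext \<Omega> u y + e\<close>, so the bound passes to a full punctured
    neighbourhood of \<open>y\<close>.\<close>
  then have "\<forall>\<^sub>F x in at y. pos_ext \<Omega> u x < pos_ext \<Omega> u y + e"
    unfolding eventually_at_filter
    using nonneg \<open>e > 0\<close> by (auto simp: pos_ext_def elim!: eventually_mono)
  then have 1: "\<forall>\<^sub>F x in at y within K. pos_ext \<Omega> u x < pos_ext \<Omega> u y + e"
    by (rule filter_leD[OF at_le[OF subset_UNIV]])
  have 2: "\<forall>\<^sub>F x in at y within K. w y - e < w x"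
    using w y \<open>e > 0\<close> unfolding continuous_on_def by (intro order_tendstoD) auto
  show "\<forall>\<^sub>F x in at y within K. pos_ext \<Omega> u x - w x < a"
    using 1 2 by eventually_elim (auto simp: e_def field_simps)
qed

text \<open>The barrier \<open>w\<close> itself is the test function. If \<open>u > w\<close>
  somewhere in \<open>D\<close>, the truncated difference has a positive maximum over the compact
  closure, and its maximum point lies in \<open>D\<close>. There the subsolution inequality holds,
  and ellipticity allows the argument \<open>u z\<close> to be lowered to \<open>0\<close>, against
  \<open>strict\<close>.\<close>

lemma viscosity_comparison:
  assumes sub: "viscosity_subsolution F \<Omega> u" and ell: "degenerate_elliptic F"
    and \<Omega>: "open \<Omega>" and D: "D \<subseteq> \<Omega>" "open D" "bounded D"
    and bdry: "\<And>y. y \<in> frontier \<Omega> \<Longrightarrow> Limsup (at y within \<Omega>) (\<lambda>x. ereal (u x)) \<le> 0"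
    and C2: "C2_on \<Omega> w" and cont: "continuous_on (closure D) w"
    and nonneg: "\<And>x. x \<in> closure D \<Longrightarrow> 0 \<le> w x"
    and cap: "\<And>x. x \<in> frontier D \<Longrightarrow> x \<in> \<Omega> \<Longrightarrow> u x \<le> w x"
    and sym: "\<And>x. x \<in> D \<Longrightarrow> sym_mat (hessian w x)"
    and strict: "\<And>x. x \<in> D \<Longrightarrow> F x 0 (grad w x) (hessian w x) > 0"
    and x: "x \<in> D"
  shows "u x \<le> w x"
proof (rule ccontr)
  assume "\<not> u x \<le> w x"
  have "compact (closure D)" "closure D \<noteq> {}"
    using D x by (auto simp: compact_closure)
  moreover have "usc_on (closure D) (\<lambda>x. pos_ext \<Omega> u x - w x)"
    using sub \<Omega> bdry cont closure_mono[OF D(1)]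
    by (intro usc_on_pos_ext_minus) (auto simp: viscosity_subsolution_def)
  ultimately obtain z where z: "z \<in> closure D"
    and max: "\<And>y. y \<in> closure D \<Longrightarrow> pos_ext \<Omega> u y - w y \<le> pos_ext \<Omega> u z - w z"
    using usc_on_compact_attains_max by blast
  have "0 < pos_ext \<Omega> u x - w x"
    using \<open>\<not> u x \<le> w x\<close> x D(1) by (auto simp: pos_ext_def)
  also have "\<dots> \<le> pos_ext \<Omega> u z - w z"
    using max x closure_subset by blast
  finally have pos: "pos_ext \<Omega> u z > w z"
    by simp
  \<comment> \<open>Off \<open>\<Omega>\<close> the extension is \<open>0\<close> while
    \<open>w \<ge> 0\<close>, so a positive difference forces \<open>z\<close> into
    \<open>\<Omega>\<close> and \<open>u z > 0\<close>.\<close>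
  then have z\<Omega>: "z \<in> \<Omega>" and uz: "pos_ext \<Omega> u z = u z" "u z > w z"
    using nonneg[OF z] by (auto simp: pos_ext_def split: if_splits)
  have "z \<in> D"
    using cap[of z] uz z z\<Omega> \<open>open D\<close> by (force simp: frontier_def interior_open)
  then obtain e where e: "e > 0" "ball z e \<subseteq> D"
    using \<open>open D\<close> open_contains_ball by blast
  have "u y - w y \<le> u z - w z" if "y \<in> \<Omega>" "dist y z < e" for y
  proof -
    have "y \<in> closure D"
      using e that closure_subset[of D] by (auto simp: dist_commute subset_iff)
    then show ?thesis
      using max[of y] uz that by (simp add: pos_ext_def)
  qed
  then have "F z (u z) (grad w z) (hessian w z) \<le> 0"
    using sub C2 z\<Omega> e(1) unfolding viscosity_subsolution_def by blast
  \<comment> \<open>Reflexivity of the semidefinite ordering: ellipticity is applied with the same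
    matrix on both sides and \<open>u z > w z \<ge> 0\<close>.\<close>
  moreover have "psd (0 :: real^'a^'a)"
    by (simp add: psd_def sym_mat_def transpose_def vec_eq_iff)
  then have "F z (u z) (grad w z) (hessian w z) \<ge> F z 0 (grad w z) (hessian w z)"
    using ell[unfolded degenerate_elliptic_def loewner_le_def, rule_format,
        OF sym[OF \<open>z \<in> D\<close>] sym[OF \<open>z \<in> D\<close>], of 0 "u z" z "grad w z"] uz nonneg[OF z]
    by simp
  ultimately show False
    using strict[OF \<open>z \<in> D\<close>] by simp
qed

subsection \<open>Radial functions\<close>

definition outer :: "real^'n \<Rightarrow> real^'n^'n" where
  "outer v = (\<chi> i j. v $ i * v $ j)"

lemma outer_mult_vec: "outer v *v h = (v \<bullet> h) *\<^sub>R v"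
  by (simp add: outer_def matrix_vector_mult_def vec_eq_iff inner_vec_def sum_distrib_left mult_ac)

lemma trace_outer: "trace (outer v) = v \<bullet> v"
  by (simp add: outer_def trace_def inner_vec_def)

lemma trace_scaleR: "trace (a *\<^sub>R X) = a * trace (X :: real^'n^'n)"
  by (simp add: trace_def sum_distrib_left)

lemma sym_mat_outer: "sym_mat (outer v)"
  by (simp add: outer_def sym_mat_def transpose_def vec_eq_iff mult.commute)

lemma sym_mat_one: "sym_mat (mat 1)"
  by (simp add: sym_mat_def)

lemma sym_mat_diff: "sym_mat X \<Longrightarrow> sym_mat Y \<Longrightarrow> sym_mat (X - Y)"
  by (simp add: sym_mat_def transpose_def vec_eq_iff)

lemma sym_mat_scaleR: "sym_mat X \<Longrightarrow> sym_mat (a *\<^sub>R X)"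
  by (simp add: sym_mat_def transpose_def vec_eq_iff)

text \<open>For a unit vector \<open>e\<close> the matrices \<open>outer e\<close> and
  \<open>mat 1 - outer e\<close> are complementary orthogonal projections: both are positive
  semidefinite, the second by Cauchy-Schwarz, and their product vanishes.\<close>

lemma pos_neg_parts_radial:
  fixes e :: "real^'n"
  assumes e: "norm e = 1" and a: "a \<ge> 0" and b: "b \<ge> 0"
  shows "pos_neg_parts (a *\<^sub>R (mat 1 - outer e) - b *\<^sub>R outer e)
           (a *\<^sub>R (mat 1 - outer e)) (b *\<^sub>R outer e)"
  unfolding pos_neg_parts_def
proof (intro conjI refl)
  have ee: "e \<bullet> e = 1"
    using e by (simp add: norm_eq_1)
  have "(e \<bullet> v)\<^sup>2 \<le> v \<bullet> v" for v
    using Cauchy_Schwarz_ineq[of e v] ee by simp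
  then show "psd (a *\<^sub>R (mat 1 - outer e))"
    unfolding psd_def using a
    by (auto simp: sym_mat_scaleR sym_mat_diff sym_mat_one sym_mat_outer outer_mult_vec
        scaleR_matrix_vector_assoc[symmetric] matrix_vector_mult_diff_rdistrib inner_diff_right
        power2_eq_square inner_commute intro!: mult_nonneg_nonneg)
  show "psd (b *\<^sub>R outer e)"
    unfolding psd_def using b
    by (auto simp: sym_mat_scaleR sym_mat_outer outer_mult_vec
        scaleR_matrix_vector_assoc[symmetric] inner_commute[of _ e] mult.assoc)
  show "(a *\<^sub>R (mat 1 - outer e)) ** (b *\<^sub>R outer e) = 0"
    unfolding matrix_eq
    by (simp add: matrix_vector_mul_assoc[symmetric] scaleR_matrix_vector_assoc[symmetric]
        outer_mult_vec matrix_vector_mult_diff_rdistrib ee matrix_vector_mult_scaleR)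
qed

lemma C2_on_subset: "C2_on S f \<Longrightarrow> T \<subseteq> S \<Longrightarrow> C2_on T f"
  unfolding C2_on_def by (auto intro: continuous_on_subset differentiable_on_subset)

section \<open>Gradient and Hessian of a radial function outside a ball about its centre\<close>

context
  fixes W g g' :: "real \<Rightarrow> real" and c :: "real^'n" and \<rho> :: real
  assumes \<rho>: "\<rho> \<ge> 0"
    and W: "\<And>r. r > \<rho> \<Longrightarrow> (W has_real_derivative g r) (at r)"
    and g: "\<And>r. r > \<rho> \<Longrightarrow> (g has_real_derivative g' r) (at r)"
begin

lemma has_derivative_norm_diff:
  assumes "norm (x - c) > \<rho>"
  shows "((\<lambda>x. norm (x - c)) has_derivative (\<lambda>h. h \<bullet> sgn (x - c))) (at x)"
proof -
  have "x - c \<noteq> 0"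
    using assms \<rho> by auto
  moreover have "((\<lambda>x. x - c) has_derivative (\<lambda>h. h)) (at x)"
    by (auto intro!: derivative_eq_intros)
  ultimately show ?thesis
    using has_derivative_compose[of "\<lambda>x. x - c" "\<lambda>h. h" x UNIV norm "\<lambda>h. h \<bullet> sgn (x - c)"]
      has_derivative_norm[of "x - c"] by simp
qed

lemma radial_has_derivative:
  assumes x: "norm (x - c) > \<rho>"
  shows "((\<lambda>x. W (norm (x - c))) has_derivative (\<lambda>h. g (norm (x - c)) * (h \<bullet> sgn (x - c)))) (at x)"
  using has_derivative_compose[OF has_derivative_norm_diff[OF x] W[OF x, unfolded has_field_derivative_def]]
  by simp

lemma radial_grad:
  assumes x: "norm (x - c) > \<rho>"
  shows "grad (\<lambda>x. W (norm (x - c))) x = g (norm (x - c)) *\<^sub>R sgn (x - c)"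
  unfolding grad_def frechet_derivative_at[OF radial_has_derivative[OF x], symmetric]
  by (simp add: vec_eq_iff inner_axis' )

text \<open>With \<open>x - c = r *\<^sub>R e\<close> the product rule gives \<open>g r / r\<close>
  in every direction, plus \<open>r\<close> times the derivative of \<open>g r / r\<close>, that is
  \<open>g' r - g r / r\<close>, in the direction \<open>e\<close>. The tangential eigenvalue is
  thus \<open>g r / r\<close> and the radial one \<open>g' r\<close>.\<close>

lemma radial_grad_has_derivative:
  assumes x: "norm (x - c) > \<rho>"
  defines "r \<equiv> norm (x - c)" and "e \<equiv> sgn (x - c)"
  shows "(grad (\<lambda>x. W (norm (x - c))) has_derivative
           (\<lambda>h. ((g r / r) *\<^sub>R (mat 1 - outer e) + g' r *\<^sub>R outer e) *v h)) (at x)"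
proof -
  have r: "r > \<rho>" "r > 0"
    using x \<rho> by (auto simp: r_def)
  \<comment> \<open>In this form of the gradient only a scalar function of the radius and the map
    \<open>x - c\<close> have to be differentiated, not \<open>sgn\<close>.\<close>
  have "((\<lambda>x. (g (norm (x - c)) / norm (x - c)) *\<^sub>R (x - c)) has_derivative
     (\<lambda>h. ((g r / r) *\<^sub>R (mat 1 - outer e) + g' r *\<^sub>R outer e) *v h)) (at x)"
  proof -
    have q: "((\<lambda>r. g r / r) has_real_derivative (g' r / r - g r / r\<^sup>2)) (at r)"
      using r by (auto intro!: derivative_eq_intros g simp: field_simps power2_eq_square)
    have "((\<lambda>x. g (norm (x - c)) / norm (x - c)) has_derivative
         (\<lambda>h. (g' r / r - g r / r\<^sup>2) * (h \<bullet> e))) (at x)"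
      using has_derivative_compose[OF has_derivative_norm_diff[OF x] q[unfolded r_def has_field_derivative_def]]
      by (simp add: r_def e_def)
    from has_derivative_scaleR[OF this has_derivative_diff[OF has_derivative_ident has_derivative_const]]
    have "((\<lambda>x. (g (norm (x - c)) / norm (x - c)) *\<^sub>R (x - c)) has_derivative
       (\<lambda>h. (g r / r) *\<^sub>R h + ((g' r / r - g r / r\<^sup>2) * (h \<bullet> e)) *\<^sub>R (x - c))) (at x)"
      by (simp only: diff_zero flip: r_def)
    moreover have "(g r / r) *\<^sub>R h + ((g' r / r - g r / r\<^sup>2) * (h \<bullet> e)) *\<^sub>R (x - c)
        = ((g r / r) *\<^sub>R (mat 1 - outer e) + g' r *\<^sub>R outer e) *v h" for h
    proof -
      have "x - c = r *\<^sub>R e"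
        using r by (simp add: r_def e_def sgn_div_norm)
      then show ?thesis
        using r by (simp add: scaleR_matrix_vector_assoc[symmetric] matrix_vector_mult_add_rdistrib
            matrix_vector_mult_diff_rdistrib outer_mult_vec inner_commute vec_eq_iff field_simps power2_eq_square)
    qed
    ultimately show ?thesis
      by simp
  qed
  moreover have "open {x. norm (x - c) > \<rho>}"
    by (intro open_Collect_less continuous_intros)
  ultimately show ?thesis
    by (rule has_derivative_transform_within_open) (use x \<rho> in \<open>auto simp: radial_grad sgn_div_norm divide_inverse\<close>)
qed

lemma radial_hessian:
  assumes x: "norm (x - c) > \<rho>"
  defines "r \<equiv> norm (x - c)" and "e \<equiv> sgn (x - c)"
  shows "hessian (\<lambda>x. W (norm (x - c))) x = (g r / r) *\<^sub>R (mat 1 - outer e) + g' r *\<^sub>R outer e"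
  unfolding hessian_def jacobian_def r_def e_def
    frechet_derivative_at[OF radial_grad_has_derivative[OF x], symmetric]
  by (rule matrix_of_matrix_vector_mul)

lemma radial_C2_on:
  assumes g': "continuous_on {\<rho><..} g'"
  shows "C2_on {x. norm (x - c) > \<rho>} (\<lambda>x. W (norm (x - c)))"
  unfolding C2_on_def
proof (intro conjI)
  let ?S = "{x. norm (x - c) > \<rho>}" and ?\<phi> = "\<lambda>x. W (norm (x - c))"
  show "?\<phi> differentiable_on ?S"
    unfolding differentiable_on_def 
    using differentiableI[OF radial_has_derivative] by (auto intro: differentiable_at_withinI)
  show "grad ?\<phi> differentiable_on ?S"
    unfolding differentiable_on_def 
    using differentiableI[OF radial_grad_has_derivative] by (auto intro: differentiable_at_withinI)
  have "continuous_on {\<rho><..} g"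
    using g by (intro DERIV_continuous_on) (auto intro: has_field_derivative_at_within)
  then have 1: "continuous_on ?S (\<lambda>x. g (norm (x - c)))"
    by (rule continuous_on_compose2) (auto intro!: continuous_intros)
  have 2: "continuous_on ?S (\<lambda>x. g' (norm (x - c)))"
    by (rule continuous_on_compose2[OF g']) (auto intro!: continuous_intros)
  have nz: "x - c \<noteq> 0" if "x \<in> ?S" for x
    using that \<rho> by auto
  have "continuous_on ?S (\<lambda>x. sgn (x - c))"
    using nz by (intro continuous_on_sgn continuous_intros) auto
  then have 3: "continuous_on ?S (\<lambda>x. outer (sgn (x - c)))"
    unfolding outer_def
    by (intro continuous_on_vec_lambda continuous_on_mult continuous_on_component)
  have "continuous_on ?S (\<lambda>x. (g (norm (x - c)) / norm (x - c)) *\<^sub>R (mat 1 - outer (sgn (x - c)))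
      + g' (norm (x - c)) *\<^sub>R outer (sgn (x - c)))"
    using nz
    by (intro continuous_on_add continuous_on_scaleR continuous_on_diff continuous_on_const
        continuous_on_divide continuous_on_norm continuous_on_id 1 2 3) auto
  then show "continuous_on ?S (hessian ?\<phi>)"
    by (rule continuous_on_eq) (simp only: mem_Collect_eq radial_hessian)
qed

end

subsection \<open>The radial profile\<close>

lemma at_within_atLeast_eq_Icc:
  fixes s T :: real
  assumes "s < T"
  shows "at s within {a..} = at s within {a..T}"
  by (rule at_within_nhd[of s "{..<T}"]) (use assms in auto)

text \<open>The one-sided derivative at the endpoint \<open>a\<close> is included, so that
  \<open>DERIV_continuous_on\<close> gives continuity on the closed half-line.\<close>

lemma integral_has_real_derivative_atLeast:
  fixes g :: "real \<Rightarrow> real"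
  assumes g: "continuous_on {a..} g" and s: "a \<le> s"
  shows "((\<lambda>x. integral {a..x} g) has_real_derivative g s) (at s within {a..})"
proof -
  have "continuous_on {a..s+1} g"
    by (rule continuous_on_subset[OF g]) auto
  then show ?thesis
    using integral_has_real_derivative[of a "s+1" g s] s at_within_atLeast_eq_Icc[of s "s+1" a] by simp
qed

lemma integral_has_real_derivative_at:
  fixes g :: "real \<Rightarrow> real"
  assumes g: "continuous_on {a..} g" and s: "a < s"
  shows "((\<lambda>x. integral {a..x} g) has_real_derivative g s) (at s)"
proof -
  have "at s within {a..} = at s"
    by (rule at_within_interior) (use s in auto)
  then show ?thesis
    using integral_has_real_derivative_atLeast[OF g, of s] s by simp
qed

lemma continuous_on_indefinite_integral_atLeast:
  fixes h :: "real \<Rightarrow> real"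
  assumes "\<And>T. h integrable_on {a..T}"
  shows "continuous_on {a..} (\<lambda>s. integral {a..s} h)"
  unfolding continuous_on_eq_continuous_within
proof
  fix s assume "s \<in> {a..}"
  then have "continuous (at s within {a..s+1}) (\<lambda>s. integral {a..s} h)"
    using indefinite_integral_continuous_1[OF assms, of "s+1"]
    by (simp add: continuous_on_eq_continuous_within)
  then show "continuous (at s within {a..}) (\<lambda>s. integral {a..s} h)"
    by (simp add: at_within_atLeast_eq_Icc[of s "s+1" a])
qed

text \<open>A nonnegative monotone function is absolutely integrable on the interval, and the
  continuous factor is bounded and measurable there. This covers \<open>A = C / lam\<close>, which
  may jump with \<open>lam\<close>.\<close>

lemma integrable_continuous_times_mono:
  fixes C h :: "real \<Rightarrow> real"
  assumes C: "continuous_on {a..b} C" and h: "mono_on {a..b} h" and h0: "\<And>s. s \<in> {a..b} \<Longrightarrow> h s \<ge> 0"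
  shows "(\<lambda>s. C s * h s) integrable_on {a..b}"
proof -
  have "h absolutely_integrable_on {a..b}"
    using integrable_on_mono_on[OF h] h0 by (intro nonnegative_absolutely_integrable_1) auto
  moreover have "C \<in> borel_measurable (lebesgue_on {a..b})"
    using C by (intro continuous_imp_measurable_on_sets_lebesgue) auto
  moreover have "bounded (C ` {a..b})"
    using C by (intro compact_imp_bounded compact_continuous_image) auto
  ultimately have "(\<lambda>s. C s * h s) absolutely_integrable_on {a..b}"
    by (intro absolutely_integrable_bounded_measurable_product_real) auto
  then show ?thesis
    by (rule absolutely_integrable_on_def[THEN iffD1, THEN conjunct1])
qed

text \<open>Averaging the monotone factor over \<open>[s, s + \<delta>]\<close> dominates it and makes it continuous.\<close>

lemma continuous_majorant:
  fixes C h :: "real \<Rightarrow> real"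
  assumes C: "continuous_on {0..} C" "antimono_on {0..} C" "\<And>t. t \<ge> 0 \<Longrightarrow> C t \<ge> 0"
    and h: "mono_on {0..} h" "\<And>t. t \<ge> 0 \<Longrightarrow> h t \<ge> 0"
    and R: "R \<ge> 0" and \<epsilon>: "\<epsilon> > 0"
  obtains B where "continuous_on {0..} B" "\<And>s. s \<ge> 0 \<Longrightarrow> C s * h s \<le> B s"
    "integral {0..R} B \<le> integral {0..R} (\<lambda>s. C s * h s) + \<epsilon>"
proof -
  define H where "H s = integral {0..s} h" for s
  \<comment> \<open>The total error will be at most \<open>C 0 * h (R + 1) * \<delta>\<close>. The
    summand \<open>1\<close> keeps the denominator positive, and \<open>\<delta> \<le> 1\<close>
    keeps \<open>R + \<delta>\<close> below \<open>R + 1\<close>.\<close>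
  define \<delta> where "\<delta> = min 1 (\<epsilon> / (C 0 * h (R + 1) + 1))"
  have Ch: "C 0 * h (R + 1) \<ge> 0"
    using C h R by simp
  then have \<delta>: "0 < \<delta>" "\<delta> \<le> 1"
    using \<epsilon> by (auto simp: \<delta>_def)
  have "C 0 * h (R + 1) * \<delta> \<le> C 0 * h (R + 1) * (\<epsilon> / (C 0 * h (R + 1) + 1))"
    using Ch by (intro mult_left_mono) (auto simp: \<delta>_def)
  also have "\<dots> \<le> \<epsilon>"
    using Ch \<epsilon> by (simp add: field_simps)
  finally have \<delta>\<epsilon>: "C 0 * h (R + 1) * \<delta> \<le> \<epsilon>" .
  have int_h: "h integrable_on {a..b}" if "a \<ge> 0" for a b
    by (rule integrable_on_mono_on, rule mono_on_subset[OF h(1)]) (use that in auto)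
  have h_mono: "h s \<le> h t" if "0 \<le> s" "s \<le> t" for s t
    using h(1) that by (auto simp: mono_on_def)
  have H_diff: "H t - H s = integral {s..t} h" if "0 \<le> s" "s \<le> t" for s t
    using Henstock_Kurzweil_Integration.integral_combine[OF that int_h] unfolding H_def by simp
  have H_lower: "h s * (t - s) \<le> H t - H s" if "0 \<le> s" "s \<le> t" for s t
    using integral_le[of "\<lambda>_. h s" "{s..t}" h] int_h[of s t] that
    by (auto simp: H_diff h_mono mult.commute)
  have H_upper: "H t - H s \<le> h t * (t - s)" if "0 \<le> s" "s \<le> t" for s t
    using integral_le[of h "{s..t}" "\<lambda>_. h t"] int_h[of s t] that
    by (auto simp: H_diff h_mono mult.commute)
  have H_cont: "continuous_on {0..} H"
    unfolding H_def using int_h by (intro continuous_on_indefinite_integral_atLeast) auto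
  define B where "B s = C s * ((H (s + \<delta>) - H s) / \<delta>)" for s
  have "continuous_on {0..} (\<lambda>s. H (s + \<delta>))"
    by (rule continuous_on_compose2[OF H_cont]) (use \<delta> in \<open>auto intro!: continuous_intros\<close>)
  then have B_cont: "continuous_on {0..} B"
    unfolding B_def using C(1) H_cont by (intro continuous_intros) (use \<delta> in auto)
  have B_ge: "C s * h s \<le> B s" if "s \<ge> 0" for s
    unfolding B_def using H_lower[of s "s + \<delta>"] \<delta> C(3) that
    by (intro mult_left_mono) (auto simp: field_simps)
  \<comment> \<open>Replacing \<open>C s\<close> by the constant \<open>C 0\<close> in the error
    leaves pure increments of \<open>h\<close>, whose integral telescopes.\<close>
  have B_le: "B s \<le> C s * h s + C 0 * (h (s + \<delta>) - h s)" if "s \<ge> 0" for s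
  proof -
    have "B s \<le> C s * h (s + \<delta>)"
      unfolding B_def using H_upper[of s "s + \<delta>"] \<delta> C(3) that
      by (intro mult_left_mono) (auto simp: field_simps)
    also have "\<dots> = C s * h s + C s * (h (s + \<delta>) - h s)"
      by (simp add: algebra_simps)
    also have "\<dots> \<le> C s * h s + C 0 * (h (s + \<delta>) - h s)"
      using C(2) h_mono[of s "s + \<delta>"] \<delta> that
      by (intro add_left_mono mult_right_mono) (auto simp: monotone_on_def)
    finally show ?thesis .
  qed
  have int_Ch: "(\<lambda>s. C s * h s) integrable_on {0..R}"
    by (rule integrable_continuous_times_mono)
      (use C h in \<open>auto intro: continuous_on_subset mono_on_subset\<close>)
  have int_B: "B integrable_on {0..R}"
    by (intro integrable_continuous_real continuous_on_subset[OF B_cont]) auto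
  have "mono_on {0..R} (\<lambda>s. h (s + \<delta>))"
    using h_mono \<delta> by (auto simp: mono_on_def)
  then have int_shift: "(\<lambda>s. h (s + \<delta>)) integrable_on {0..R}"
    by (rule integrable_on_mono_on)
  \<comment> \<open>After the shift only pieces of length \<open>\<delta>\<close> at the two ends
    survive: the one at \<open>R\<close> is at most \<open>h (R + 1) * \<delta>\<close>, the one at
    \<open>0\<close> enters with a negative sign.\<close>
  have "integral {0..R} (\<lambda>s. h (s + \<delta>)) = integral {\<delta>..R + \<delta>} h"
    using integral_shift_Icc_real[of 0 R h \<delta>] by (simp add: o_def add.commute)
  also have "\<dots> = H (R + \<delta>) - H \<delta>"
    using H_diff[of \<delta> "R + \<delta>"] \<delta> R by simp
  finally have shift: "integral {0..R} (\<lambda>s. h (s + \<delta>)) - integral {0..R} h = H (R + \<delta>) - H R - H \<delta>"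
    by (simp add: H_def)
  have "integral {0..R} B \<le> integral {0..R} (\<lambda>s. C s * h s + C 0 * (h (s + \<delta>) - h s))"
    using B_le int_B int_Ch int_shift int_h[of 0 R] R
    by (intro integral_le integrable_add integrable_on_mult_right integrable_diff) auto
  also have "\<dots> = integral {0..R} (\<lambda>s. C s * h s) + C 0 * (H (R + \<delta>) - H R - H \<delta>)"
    using int_Ch int_shift int_h[of 0 R]
    by (simp add: shift[symmetric] Henstock_Kurzweil_Integration.integral_add
        Henstock_Kurzweil_Integration.integral_diff integrable_diff integrable_on_mult_right
        del: right_diff_distrib)
  also have "C 0 * (H (R + \<delta>) - H R - H \<delta>) \<le> C 0 * (h (R + 1) * \<delta>)"
  proof (rule mult_left_mono)
    have "H (R + \<delta>) - H R \<le> h (R + \<delta>) * \<delta>"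
      using H_upper[of R "R + \<delta>"] R \<delta> by simp
    also have "\<dots> \<le> h (R + 1) * \<delta>"
      using h_mono R \<delta> by (intro mult_right_mono) auto
    moreover have "H \<delta> \<ge> 0"
      using H_lower[of 0 \<delta>] \<delta> h(2)[of 0] by (smt (verit) H_def integral_refl mult_nonneg_nonneg cbox_interval box_real(2))
    ultimately show "H (R + \<delta>) - H R - H \<delta> \<le> h (R + 1) * \<delta>"
      by linarith
  qed (use C in auto)
  finally have "integral {0..R} B \<le> integral {0..R} (\<lambda>s. C s * h s) + \<epsilon>"
    using \<delta>\<epsilon> by (simp add: mult.assoc)
  with B_cont B_ge show thesis
    by (rule that)
qed

text \<open>The solution of \<open>y' = - (y powr k)\<close> with \<open>y 0 = \<nu>\<close>, for
  \<open>\<nu> > 0\<close>. Thus \<open>f_nu\<close> is this solution run with the integral of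
  \<open>A\<close> as its time.\<close>

definition decay :: "real \<Rightarrow> real \<Rightarrow> real \<Rightarrow> real" where
  "decay k \<nu> I =
     (if k = 1 then \<nu> * exp (- I) else ((k - 1) * I + \<nu> powr (1 - k)) powr (1 / (1 - k)))"

lemma f_nu_eq_decay: "f_nu k A \<nu> t = decay k \<nu> (integral {0..t} A)"
  by (simp add: f_nu_def decay_def)

lemma decay_pos:
  assumes "k \<ge> 1" "\<nu> > 0" "I \<ge> 0"
  shows "decay k \<nu> I > 0"
proof -
  have "0 < (k - 1) * I + \<nu> powr (1 - k)"
    using assms by (intro add_nonneg_pos) auto
  then show ?thesis
    using assms by (simp add: decay_def)
qed

lemma decay_antimono:
  assumes "k \<ge> 1" "\<nu> > 0" "0 \<le> I" "I \<le> J"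
  shows "decay k \<nu> J \<le> decay k \<nu> I"
proof -
  have "0 < (k - 1) * I + \<nu> powr (1 - k)"
    using assms by (intro add_nonneg_pos) auto
  then show ?thesis
    using assms by (auto simp: decay_def mult_left_mono intro!: powr_mono2')
qed

text \<open>For \<open>k > 1\<close> the chain rule factor \<open>(k - 1) / (1 - k)\<close> is
  \<open>-1\<close>, and lowering the exponent \<open>1 / (1 - k)\<close> by one gives
  \<open>k / (1 - k)\<close>, the exponent of the \<open>k\<close>-th power.\<close>

lemma decay_has_derivative:
  assumes "k \<ge> 1" "\<nu> > 0" "I \<ge> 0"
  shows "(decay k \<nu> has_real_derivative - (decay k \<nu> I powr k)) (at I)"
proof (cases "k = 1")
  case True
  then show ?thesis
    using assms by (auto simp: decay_def[abs_def] intro!: derivative_eq_intros)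
next
  case False
  let ?a = "\<lambda>I. (k - 1) * I + \<nu> powr (1 - k)"
  have a: "?a I > 0"
    using assms by (intro add_nonneg_pos) auto
  have "((\<lambda>I. ?a I powr (1 / (1 - k))) has_real_derivative
          1 / (1 - k) * ?a I powr (1 / (1 - k) - 1) * (k - 1)) (at I)"
    using a by (auto intro!: derivative_eq_intros DERIV_fun_powr[THEN DERIV_cong])
  moreover have "1 / (1 - k) * ?a I powr (1 / (1 - k) - 1) * (k - 1) = - ((?a I powr (1 / (1 - k))) powr k)"
  proof -
    have "1 / (1 - k) - 1 = k / (1 - k)" "1 / (1 - k) * p * (k - 1) = - p" for p
      using False by (auto simp: field_simps)
    moreover have "(?a I powr (1 / (1 - k))) powr k = ?a I powr (k / (1 - k))"
      unfolding powr_powr by simp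
    ultimately show ?thesis
      by simp
  qed
  ultimately show ?thesis
    using False by (simp add: decay_def[abs_def])
qed

lemma continuous_on_decay:
  assumes "k \<ge> 1" "\<nu> > 0"
  shows "continuous_on {0..} (decay k \<nu>)"
  using DERIV_isCont[OF decay_has_derivative[OF assms]]
  by (intro continuous_at_imp_continuous_on) auto

text \<open>The bound \<open>J \<le> I + 1\<close> serves \<open>k = 1\<close>, at the cost of a
  factor \<open>exp (-1)\<close>. The bound \<open>J \<le> 2 * I\<close> serves
  \<open>k > 1\<close>: it at most doubles the base, at the cost of
  \<open>2 powr (1 / (1 - k))\<close>. Neither factor depends on \<open>\<nu>\<close>,
  \<open>I\<close> or \<open>J\<close>.\<close>

lemma decay_lower_bound:
  assumes k: "k \<ge> 1"
  obtains q where "q > 0" 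
    "\<And>\<nu> I J. \<nu> > 0 \<Longrightarrow> I \<ge> 0 \<Longrightarrow> J \<ge> 0 \<Longrightarrow> J \<le> I + min 1 I \<Longrightarrow> q * decay k \<nu> I \<le> decay k \<nu> J"
proof (cases "k = 1")
  case True
  have "exp (-1) * decay k \<nu> I \<le> decay k \<nu> J" if "\<nu> > 0" "J \<le> I + min 1 I" for \<nu> I J
    using that True by (simp add: decay_def mult.left_commute flip: exp_add)
  then show thesis
    using that[of "exp (-1)"] by simp
next
  case False
  have "2 powr (1 / (1 - k)) * decay k \<nu> I \<le> decay k \<nu> J"
    if "\<nu> > 0" "I \<ge> 0" "J \<ge> 0" "J \<le> I + min 1 I" for \<nu> I J
  proof -
    have pos: "0 < (k - 1) * I + \<nu> powr (1 - k)" "0 < (k - 1) * J + \<nu> powr (1 - k)"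
      using k that by (auto intro!: add_nonneg_pos)
    have "(k - 1) * J \<le> (k - 1) * (2 * I)"
      using k that by (intro mult_left_mono) auto
    then have "(k - 1) * J + \<nu> powr (1 - k) \<le> 2 * ((k - 1) * I + \<nu> powr (1 - k))"
      by (simp add: algebra_simps) (smt (verit) powr_ge_zero)
    then have "(2 * ((k - 1) * I + \<nu> powr (1 - k))) powr (1 / (1 - k)) \<le> ((k - 1) * J + \<nu> powr (1 - k)) powr (1 / (1 - k))"
      using pos k by (intro powr_mono2') auto
    then show ?thesis
      using pos False by (simp only: decay_def powr_mult if_False)
  qed
  then show thesis
    using that[of "2 powr (1 / (1 - k))"] by simp
qed

section \<open>The damped profile and its differential inequality\<close>

definition profile :: "real \<Rightarrow> (real \<Rightarrow> real) \<Rightarrow> real \<Rightarrow> real \<Rightarrow> real \<Rightarrow> real" where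
  "profile k B \<nu> \<kappa> s = exp (- \<kappa> * integral {0..s} B) * f_nu k B \<nu> s"

definition profile_deriv :: "real \<Rightarrow> (real \<Rightarrow> real) \<Rightarrow> real \<Rightarrow> real \<Rightarrow> real \<Rightarrow> real" where
  "profile_deriv k B \<nu> \<kappa> s =
     - \<kappa> * B s * profile k B \<nu> \<kappa> s - B s * (exp (- \<kappa> * integral {0..s} B) * f_nu k B \<nu> s powr k)"

context
  fixes k \<nu> \<kappa> :: real and B :: "real \<Rightarrow> real"
  assumes k: "k \<ge> 1" and \<nu>: "\<nu> > 0" and \<kappa>: "\<kappa> \<ge> 0"
    and B: "continuous_on {0..} B" and B_nonneg: "\<And>s. s \<ge> 0 \<Longrightarrow> B s \<ge> 0"
begin

text \<open>For negative \<open>s\<close> the interval is empty and the integral is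
  \<open>0\<close>, so positivity of the profile holds at every real \<open>s\<close>.\<close>

lemma integral_B_nonneg: "integral {0..s} B \<ge> 0"
  using B B_nonneg by (intro integral_nonneg integrable_continuous_real) (auto intro: continuous_on_subset)

lemma profile_pos: "profile k B \<nu> \<kappa> s > 0"
  using decay_pos[OF k \<nu> integral_B_nonneg] by (simp add: profile_def f_nu_eq_decay)

lemma profile_has_derivative_within:
  assumes s: "s \<ge> 0"
  shows "(profile k B \<nu> \<kappa> has_real_derivative profile_deriv k B \<nu> \<kappa> s) (at s within {0..})"
proof -
  note b = integral_has_real_derivative_atLeast[OF B s]
  have d: "((\<lambda>s. f_nu k B \<nu> s) has_real_derivative - (f_nu k B \<nu> s powr k) * B s) (at s within {0..})"
    unfolding f_nu_eq_decay
    by (rule DERIV_chain2[OF decay_has_derivative[OF k \<nu> integral_B_nonneg] b])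
  show ?thesis
    unfolding profile_def[abs_def]
    by (rule DERIV_cong, (rule derivative_eq_intros b d refl)+)
      (simp add: profile_deriv_def profile_def algebra_simps)
qed

lemma profile_has_derivative:
  assumes "s > 0"
  shows "(profile k B \<nu> \<kappa> has_real_derivative profile_deriv k B \<nu> \<kappa> s) (at s)"
proof -
  have "at s within {0..} = at s"
    by (rule at_within_interior) (use assms in auto)
  then show ?thesis
    using profile_has_derivative_within[of s] assms by simp
qed

lemma continuous_on_profile: "continuous_on {0..} (profile k B \<nu> \<kappa>)"
  using profile_has_derivative_within by (intro DERIV_continuous_on) auto

lemma continuous_on_profile_deriv: "continuous_on {0..} (profile_deriv k B \<nu> \<kappa>)"
proof -
  have b: "continuous_on {0..} (\<lambda>s. integral {0..s} B)"
    using integral_has_real_derivative_atLeast[OF B] by (intro DERIV_continuous_on) auto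
  have d: "continuous_on {0..} (f_nu k B \<nu>)"
    unfolding f_nu_eq_decay[abs_def]
    by (rule continuous_on_compose2[OF continuous_on_decay[OF k \<nu>] b]) (use integral_B_nonneg in auto)
  have "f_nu k B \<nu> s \<noteq> 0" for s
    using decay_pos[OF k \<nu> integral_B_nonneg] unfolding f_nu_eq_decay by (metis less_irrefl)
  then show ?thesis
    unfolding profile_deriv_def[abs_def]
    using B b d by (intro continuous_intros continuous_on_profile) auto
qed

text \<open>The damping factor \<open>E = exp (- \<kappa> * integral {0..s} B)\<close> is at most
  \<open>1\<close> and \<open>k \<ge> 1\<close>, so \<open>E powr k \<le> E\<close>. The exact
  derivative carries \<open>E\<close> to the first power, which therefore dominates the
  \<open>k\<close>-th power of the profile.\<close>

lemma profile_deriv_le: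
  assumes "s \<ge> 0"
  shows "profile_deriv k B \<nu> \<kappa> s \<le> - \<kappa> * B s * profile k B \<nu> \<kappa> s - B s * profile k B \<nu> \<kappa> s powr k"
proof -
  have "0 \<le> \<kappa> * integral {0..s} B"
    using \<kappa> integral_B_nonneg[of s] by simp
  then have "1 * (\<kappa> * integral {0..s} B) \<le> k * (\<kappa> * integral {0..s} B)"
    using k by (intro mult_right_mono) auto
  then have "exp (- \<kappa> * integral {0..s} B) powr k \<le> exp (- \<kappa> * integral {0..s} B)"
    by (simp add: exp_powr_real algebra_simps)
  then have "profile k B \<nu> \<kappa> s powr k \<le> exp (- \<kappa> * integral {0..s} B) * f_nu k B \<nu> s powr k"
    by (simp add: profile_def powr_mult mult_right_mono)
  then show ?thesis
    using B_nonneg[OF assms] by (simp add: profile_deriv_def mult_left_mono)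
qed

lemma profile_antimono:
  assumes "0 \<le> s" "s \<le> t"
  shows "profile k B \<nu> \<kappa> t \<le> profile k B \<nu> \<kappa> s"
proof -
  have "integral {0..s} B \<le> integral {0..t} B"
    using assms B B_nonneg by (intro integral_subset_le integrable_continuous_real) (auto intro: continuous_on_subset)
  then show ?thesis
    unfolding profile_def f_nu_eq_decay
    using decay_antimono[OF k \<nu> integral_B_nonneg] decay_pos[OF k \<nu> integral_B_nonneg] \<kappa>
    by (intro mult_mono) (auto simp: mult_left_mono less_imp_le)
qed

end

subsection \<open>Barriers in the regions \<open>D(R)\<close>\<close>

lemma half_space_topology:
  shows open_half_space: "open (half_space N)"
    and closure_half_space: "closure (half_space N) = {x. x $ N \<ge> 0}"
    and frontier_half_space: "frontier (half_space N) = {x. x $ N = 0}"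
proof -
  show o: "open (half_space N)"
    unfolding half_space_def by (intro open_Collect_less continuous_intros)
  show c: "closure (half_space N) = {x. x $ N \<ge> 0}"
    unfolding half_space_def by (rule closure_halfspace_component_gt)
  show "frontier (half_space N) = {x. x $ N = 0}"
    using o c by (auto simp: frontier_def interior_open half_space_def)
qed

text \<open>For \<open>g = \<gamma> R\<close> this is the centre of the sphere that carries the
  curved part of the boundary of \<open>D(R)\<close>. The function \<open>height\<close> is the
  signed distance to the sphere about it through the origin.\<close>

definition cen :: "'n::finite \<Rightarrow> real \<Rightarrow> real^'n" where
  "cen N g = - (g *\<^sub>R axis N 1)"

definition height :: "'n::finite \<Rightarrow> real \<Rightarrow> real^'n \<Rightarrow> real" where
  "height N g x = norm (x - cen N g) - g"

lemma norm_minus_cen_sq: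
  "(norm (x - cen N g))\<^sup>2 = (\<Sum>i\<in>UNIV - {N}. (x $ i)\<^sup>2) + (x $ N + g)\<^sup>2"
proof -
  have "(norm (x - cen N g))\<^sup>2 = (\<Sum>i\<in>UNIV. (x $ i + g * axis N 1 $ i)\<^sup>2)"
    by (simp add: cen_def power2_norm_eq_inner inner_vec_def) (simp add: power2_eq_square)
  also have "\<dots> = (\<Sum>i\<in>UNIV - {N}. (x $ i + g * axis N 1 $ i)\<^sup>2) + (x $ N + g)\<^sup>2"
    by (subst sum.remove[of UNIV N]) (auto simp: axis_def)
  also have "(\<Sum>i\<in>UNIV - {N}. (x $ i + g * axis N 1 $ i)\<^sup>2) = (\<Sum>i\<in>UNIV - {N}. (x $ i)\<^sup>2)"
    by (rule sum.cong) (auto simp: axis_def)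
  finally show ?thesis .
qed

text \<open>Together with \<open>height_le_norm\<close> this lets \<open>lam\<close> at
  \<open>x $ N\<close> and \<open>C\<close> at \<open>norm x\<close> both be compared with their
  values at the single number \<open>height N g x\<close>.\<close>

lemma component_le_height:
  "x $ N \<le> height N g x"
  using component_le_norm_cart[of "x - cen N g" N] by (simp add: height_def cen_def axis_def)

lemma height_le_norm: "g \<ge> 0 \<Longrightarrow> height N g x \<le> norm x"
  using norm_triangle_ineq4[of x "cen N g"] by (simp add: height_def cen_def)

text \<open>Moving the centre down by \<open>g' - g\<close> increases the distance to it by at most
  \<open>g' - g\<close>.\<close>

lemma height_antimono:
  assumes "g \<le> g'"
  shows "height N g' x \<le> height N g x"
proof -
  have eq: "x - cen N g' = (x - cen N g) + (g' - g) *\<^sub>R axis N 1"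
    by (simp add: cen_def algebra_simps)
  show ?thesis
    using norm_triangle_ineq[of "x - cen N g" "(g' - g) *\<^sub>R axis N 1"] assms
    unfolding height_def eq by simp
qed

lemma height_axis:
  assumes "\<And>i. i \<noteq> N \<Longrightarrow> x $ i = 0" and "x $ N \<ge> 0" "g \<ge> 0"
  shows "height N g x = x $ N"
proof -
  have "(norm (x - cen N g))\<^sup>2 = (x $ N + g)\<^sup>2"
    using assms(1) by (simp add: norm_minus_cen_sq)
  then show ?thesis
    using assms by (simp add: height_def power2_eq_iff_nonneg)
qed

lemma continuous_on_height [continuous_intros]: "continuous_on S (height N g)"
  unfolding height_def[abs_def] by (intro continuous_intros)

lemma D_region_eq:
  assumes "R + \<gamma> R \<ge> 0"
  shows "D_region N \<gamma> R = {x. x $ N > 0 \<and> height N (\<gamma> R) x < R}"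
proof -
  have "(\<Sum>i\<in>UNIV - {N}. (x $ i)\<^sup>2) + (x $ N + \<gamma> R)\<^sup>2 < (R + \<gamma> R)\<^sup>2 \<longleftrightarrow> height N (\<gamma> R) x < R" for x
  proof -
    have "height N (\<gamma> R) x < R \<longleftrightarrow> norm (x - cen N (\<gamma> R)) < R + \<gamma> R"
      by (auto simp: height_def)
    also have "\<dots> \<longleftrightarrow> (norm (x - cen N (\<gamma> R)))\<^sup>2 < (R + \<gamma> R)\<^sup>2"
      using power_strict_mono[of "norm (x - cen N (\<gamma> R))" "R + \<gamma> R" 2] assms
        power_less_imp_less_base[of "norm (x - cen N (\<gamma> R))" 2 "R + \<gamma> R"] by auto
    finally show ?thesis
      unfolding norm_minus_cen_sq by (rule sym)
  qed
  then show ?thesis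
    unfolding D_region_def half_space_def by simp
qed

lemma D_region_topology:
  fixes N :: "'n::finite"
  assumes "R + \<gamma> R \<ge> 0"
  shows open_D_region: "open (D_region N \<gamma> R)"
    and bounded_D_region: "bounded (D_region N \<gamma> R)"
    and closure_D_region: "closure (D_region N \<gamma> R) \<subseteq> {x. x $ N \<ge> 0 \<and> height N (\<gamma> R) x \<le> R}"
proof -
  show "open (D_region N \<gamma> R)"
    unfolding D_region_eq[where R=R and \<gamma>=\<gamma>, OF assms] by (intro open_Collect_conj open_Collect_less continuous_intros)
  have "D_region N \<gamma> R \<subseteq> ball (cen N (\<gamma> R)) (R + \<gamma> R)"
    unfolding D_region_eq[where R=R and \<gamma>=\<gamma>, OF assms] by (auto simp: height_def dist_norm norm_minus_commute)
  then show "bounded (D_region N \<gamma> R)"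
    by (rule bounded_subset[OF bounded_ball])
  show "closure (D_region N \<gamma> R) \<subseteq> {x. x $ N \<ge> 0 \<and> height N (\<gamma> R) x \<le> R}"
    unfolding D_region_eq[where R=R and \<gamma>=\<gamma>, OF assms]
    by (intro closure_minimal closed_Collect_conj closed_Collect_le continuous_intros) auto
qed

section \<open>The hypotheses with the constant \<open>c\<close> fixed, and the supremum over the
  boundary of \<open>D(R)\<close>\<close>

locale growth_problem =
  fixes N :: "'n::finite"
    and k \<nu> c :: real
    and F :: "real^'n \<Rightarrow> real \<Rightarrow> real^'n \<Rightarrow> real^'n^'n \<Rightarrow> real"
    and C lam Lam A \<gamma> :: "real \<Rightarrow> real"
    and u :: "real^'n \<Rightarrow> real"
    and xbar :: "real^'n"
  assumes k: "k \<ge> 1"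
    and ell: "degenerate_elliptic F"
    and C_pos: "\<And>t. t \<ge> 0 \<Longrightarrow> C t > 0"
    and lam_pos: "\<And>t. t \<ge> 0 \<Longrightarrow> lam t > 0"
    and Lam_pos: "\<And>t. t \<ge> 0 \<Longrightarrow> Lam t > 0"
    and C_cont: "continuous_on {0..} C"
    and C_anti: "antimono_on {0..} C"
    and lam_anti: "antimono_on {0..} lam"
    and Lam_mono: "mono_on {0..} Lam"
    and F_bound: "\<And>x p X P Q. x $ N \<ge> 0 \<Longrightarrow> sym_mat X \<Longrightarrow> pos_neg_parts X P Q \<Longrightarrow>
        - F x 0 p X \<le> C (norm x) * norm p powr k + Lam (x $ N) * trace P - lam (x $ N) * trace Q"
    and A_eq: "\<And>t. t \<ge> 0 \<Longrightarrow> A t = C t / lam t"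
    and \<gamma>_pos: "\<And>R. R > 0 \<Longrightarrow> \<gamma> R > 0"
    and \<gamma>_mono: "mono_on {0<..} \<gamma>"
    and c_pos: "c > 0"
    and \<gamma>_bound: "\<And>R. R > 0 \<Longrightarrow> Lam R / C R * integral {0..R} A \<le> c * \<gamma> R"
    and sub: "viscosity_subsolution F (half_space N) u"
    and bdry: "\<And>y. y \<in> frontier (half_space N) \<Longrightarrow>
        Limsup (at y within half_space N) (\<lambda>x. ereal (u x)) \<le> 0"
    and \<nu>: "\<nu> > 0"
    and xbar_in: "xbar \<in> half_space N"
    and xbar_axis: "\<And>i. i \<noteq> N \<Longrightarrow> xbar $ i = 0"
    and u_xbar: "u xbar \<ge> integral {0..xbar $ N} (f_nu k A \<nu>)"
begin

lemma C_antimono: "0 \<le> s \<Longrightarrow> s \<le> t \<Longrightarrow> C t \<le> C s"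
  using C_anti by (auto simp: monotone_on_def)

lemma lam_antimono: "0 \<le> s \<Longrightarrow> s \<le> t \<Longrightarrow> lam t \<le> lam s"
  using lam_anti by (auto simp: monotone_on_def)

lemma Lam_le: "0 \<le> s \<Longrightarrow> s \<le> t \<Longrightarrow> Lam s \<le> Lam t"
  using Lam_mono by (auto simp: mono_on_def)

lemma A_pos: "t \<ge> 0 \<Longrightarrow> A t > 0"
  using C_pos lam_pos by (simp add: A_eq)

text \<open>This exhibits \<open>A\<close> as a continuous function times a nondecreasing one, the
  form that the integrability lemma and the continuous majorant require.\<close>

lemma mono_inverse_lam: "mono_on {0..} (\<lambda>t. 1 / lam t)"
  using lam_antimono lam_pos by (auto simp: mono_on_def intro!: divide_left_mono mult_pos_pos)

lemma A_integrable: "A integrable_on {0..T}"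
proof -
  have "(\<lambda>t. C t * (1 / lam t)) integrable_on {0..T}"
    by (rule integrable_continuous_times_mono)
      (use C_cont mono_inverse_lam lam_pos in
        \<open>auto intro: continuous_on_subset mono_on_subset simp: less_imp_le\<close>)
  then show ?thesis
    by (rule integrable_eq) (simp add: A_eq)
qed

lemma integral_A_nonneg: "integral {0..T} A \<ge> 0"
  using A_pos by (intro integral_nonneg A_integrable) (auto simp: less_imp_le)

text \<open>On \<open>{0..T}\<close> monotonicity of \<open>C\<close> and \<open>lam\<close> bounds
  \<open>A\<close> below by the positive constant \<open>C T / lam 0\<close>.\<close>

lemma integral_A_pos:
  assumes "T > 0"
  shows "integral {0..T} A > 0"
proof -
  have "0 < T * (C T / lam 0)"
    using assms C_pos lam_pos by simp
  also have "\<dots> = integral {0..T} (\<lambda>_. C T / lam 0)"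
    using assms by simp
  also have "\<dots> \<le> integral {0..T} A"
    using C_antimono lam_antimono C_pos lam_pos
    by (intro integral_le A_integrable) (auto simp: A_eq less_imp_le intro!: frac_le)
  finally show ?thesis .
qed

lemma continuous_on_f_nu: "continuous_on {0..} (f_nu k A \<nu>)"
  unfolding f_nu_eq_decay[abs_def]
  by (rule continuous_on_compose2[OF continuous_on_decay[OF k \<nu>]
        continuous_on_indefinite_integral_atLeast[OF A_integrable]])
    (use integral_A_nonneg in auto)

lemma f_nu_pos: "f_nu k A \<nu> s > 0"
  unfolding f_nu_eq_decay by (rule decay_pos[OF k \<nu> integral_A_nonneg])

lemma radius_nonneg: "R > 0 \<Longrightarrow> R + \<gamma> R \<ge> 0"
  using \<gamma>_pos[of R] by simp

text \<open>A point of the closure outside the open region violates one of its two strict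
  inequalities. On the flat part the boundary condition applies, so nonnegative barriers dominate
  there and only the cap needs attention.\<close>

lemma frontier_D_region_cases:
  assumes R: "R > 0" and y: "y \<in> frontier (D_region N \<gamma> R)"
  obtains (cap) "y \<in> half_space N" "height N (\<gamma> R) y = R" "upper_ext (half_space N) u y = ereal (u y)"
  | (flat) "y \<notin> half_space N" "upper_ext (half_space N) u y \<le> 0"
proof -
  have "y \<in> closure (D_region N \<gamma> R)" "y \<notin> D_region N \<gamma> R"
    using y interior_open[OF open_D_region[where R=R and \<gamma>=\<gamma>, OF radius_nonneg[OF R]]]
    by (auto simp: frontier_def)
  then have *: "y $ N \<ge> 0" "height N (\<gamma> R) y \<le> R" "\<not> (y $ N > 0 \<and> height N (\<gamma> R) y < R)"
    using closure_D_region[where R=R and \<gamma>=\<gamma>, OF radius_nonneg[OF R]] by (auto simp: D_region_eq[where R=R and \<gamma>=\<gamma>, OF radius_nonneg[OF R]])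
  show thesis
  proof (cases "y \<in> half_space N")
    case True
    then show thesis
      using * by (intro cap) (auto simp: half_space_def upper_ext_def)
  next
    case False
    then have "y $ N = 0"
      using * by (auto simp: half_space_def)
    then have "y \<in> frontier (half_space N)"
      by (simp add: frontier_half_space)
    then show thesis
      using False bdry by (intro flat) (auto simp: upper_ext_def)
  qed
qed

text \<open>The maximum of the truncated extension over the compact closure dominates the cap and,
  being nonnegative, the flat part.\<close>

lemma M_sup_bounded_above:
  assumes R: "R > 0"
  shows "\<exists>b. M_sup N \<gamma> u R \<le> ereal b"
proof (cases "D_region N \<gamma> R = {}")
  case True
  then show ?thesis
    by (auto simp: M_sup_def)
next
  case False
  let ?K = "closure (D_region N \<gamma> R)"
  have "compact ?K"
    using bounded_D_region[where R=R and \<gamma>=\<gamma>, OF radius_nonneg[OF R]] by (simp add: compact_closure)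
  moreover have "?K \<noteq> {}"
    using False by simp
  moreover have "usc_on ?K (\<lambda>x. pos_ext (half_space N) u x - 0)"
    using sub bdry closure_D_region[where R=R and \<gamma>=\<gamma>, OF radius_nonneg[OF R]]
    unfolding viscosity_subsolution_def
    by (intro usc_on_pos_ext_minus open_half_space) (auto simp: closure_half_space)
  ultimately obtain z
    where "z \<in> ?K" and "\<And>y. y \<in> ?K \<Longrightarrow> pos_ext (half_space N) u y - 0 \<le> pos_ext (half_space N) u z - 0"
    by (rule usc_on_compact_attains_max) (rule that)
  then have z: "y \<in> ?K \<Longrightarrow> pos_ext (half_space N) u y \<le> pos_ext (half_space N) u z" for y
    by simp
  have "M_sup N \<gamma> u R \<le> ereal (pos_ext (half_space N) u z)"
    unfolding M_sup_def
  proof (rule SUP_least)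
    fix y assume y: "y \<in> frontier (D_region N \<gamma> R)"
    from R y show "upper_ext (half_space N) u y \<le> ereal (pos_ext (half_space N) u z)"
    proof (cases rule: frontier_D_region_cases)
      case cap
      have "u y \<le> pos_ext (half_space N) u y"
        using cap by (simp add: pos_ext_def)
      also have "\<dots> \<le> pos_ext (half_space N) u z"
        using y by (intro z) (auto simp: frontier_def)
      finally show ?thesis
        using cap by simp
    next
      case flat
      have "(0::ereal) \<le> ereal (pos_ext (half_space N) u z)"
        by (simp add: pos_ext_def)
      with flat show ?thesis
        by (metis order_trans)
    qed
  qed
  then show ?thesis ..
qed

section \<open>Barriers for one fixed radius \<open>R\<close> and one continuous majorant
  \<open>B\<close> of \<open>A\<close>\<close>

context
  fixes R :: real and B :: "real \<Rightarrow> real" and \<kappa> :: real and G W :: "real \<Rightarrow> real"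
  assumes R: "R > 0"
    and B: "continuous_on {0..} B" and A_le_B: "\<And>s. s \<ge> 0 \<Longrightarrow> A s \<le> B s"
  defines "\<kappa> \<equiv> CARD('n) * c / integral {0..R} A"
    and "G \<equiv> profile k B \<nu> \<kappa>"
    and "W \<equiv> \<lambda>s. integral {0..s} G"
begin

lemma B_pos: "s \<ge> 0 \<Longrightarrow> B s > 0"
  using A_le_B A_pos by (meson less_le_trans)

lemma kappa_pos: "\<kappa> > 0"
  unfolding \<kappa>_def using c_pos integral_A_pos[OF R] by simp

lemmas prof = k \<nu> less_imp_le[OF kappa_pos] B less_imp_le[OF B_pos]

lemma G_pos: "G s > 0"
  unfolding G_def using prof by (rule profile_pos)

lemma G_cont: "continuous_on {0..} G"
  unfolding G_def using prof by (rule continuous_on_profile)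

lemma G_integrable: "0 \<le> s \<Longrightarrow> G integrable_on {s..t}"
  by (intro integrable_continuous_real continuous_on_subset[OF G_cont]) auto

lemma W_deriv: "s > 0 \<Longrightarrow> (W has_real_derivative G s) (at s)"
  unfolding W_def by (rule integral_has_real_derivative_at[OF G_cont])

lemma W_cont: "continuous_on {0..} W"
  unfolding W_def using integral_has_real_derivative_atLeast[OF G_cont]
  by (intro DERIV_continuous_on) auto

lemma W_diff: "0 \<le> s \<Longrightarrow> s \<le> t \<Longrightarrow> W t - W s = integral {s..t} G"
  unfolding W_def using Henstock_Kurzweil_Integration.integral_combine[of 0 s t G] G_integrable by force

lemma W_mono: "0 \<le> s \<Longrightarrow> s \<le> t \<Longrightarrow> W s \<le> W t"
  using W_diff[of s t] integral_nonneg[OF G_integrable, of s t] G_pos by (simp add: less_imp_le)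

lemma W_nonneg: "W s \<ge> 0"
  unfolding W_def using integral_nonneg[OF G_integrable, of 0 s] G_pos by (simp add: less_imp_le)

text \<open>The slope \<open>G\<close> is nonincreasing, so on \<open>{s..t}\<close> it is at least
  \<open>G t\<close>.\<close>

lemma W_diff_ge:
  assumes "0 \<le> s" "s \<le> t"
  shows "(t - s) * G t \<le> W t - W s"
proof -
  have "(t - s) * G t = integral {s..t} (\<lambda>_. G t)"
    using assms by simp
  also have "\<dots> \<le> integral {s..t} G"
    using assms G_integrable profile_antimono[OF prof, folded G_def]
    by (intro integral_le) auto
  finally show ?thesis
    using W_diff[OF assms] by simp
qed

lemma integral_A_le_B: "integral {0..s} A \<le> integral {0..s} B"
  by (intro integral_le A_integrable integrable_continuous_real[OF continuous_on_subset[OF B]])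
    (auto intro: A_le_B)

text \<open>Passing from \<open>A\<close> to \<open>B\<close> can only lower \<open>f_nu\<close>,
  and for \<open>s > 0\<close> the damping factor is strictly below \<open>1\<close>.\<close>

lemma G_less_f_nu:
  assumes "s > 0"
  shows "G s < f_nu k A \<nu> s"
proof -
  have "integral {0..s} B > 0"
    using integral_A_pos[OF assms] integral_A_le_B[of s] by simp
  then have "exp (- \<kappa> * integral {0..s} B) < 1"
    using kappa_pos by simp
  moreover have "f_nu k B \<nu> s \<le> f_nu k A \<nu> s"
    unfolding f_nu_eq_decay by (rule decay_antimono[OF k \<nu> integral_A_nonneg integral_A_le_B])
  ultimately show ?thesis
    unfolding G_def profile_def using f_nu_pos[of s]
    by (smt (verit) exp_gt_zero mult_left_mono mult_less_cancel_right2)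
qed

text \<open>The strict inequality is what later contradicts the non-strict lower bound for
  \<open>u xbar\<close>.\<close>

lemma W_less_integral_f_nu:
  assumes "x > 0"
  shows "W x < integral {0..x} (f_nu k A \<nu>)"
proof -
  let ?g = "\<lambda>s. f_nu k A \<nu> s - G s"
  have cont: "continuous_on {0..} ?g"
    by (intro continuous_intros continuous_on_f_nu G_cont)
  have "integral {0..0} ?g < integral {0..x} ?g"
  proof (rule DERIV_pos_imp_increasing_open[OF assms])
    show "\<exists>y. ((\<lambda>x. integral {0..x} ?g) has_real_derivative y) (at s) \<and> 0 < y" if "0 < s" for s
      using integral_has_real_derivative_at[OF cont that] G_less_f_nu[OF that] by auto
    show "continuous_on {0..x} (\<lambda>x. integral {0..x} ?g)"
      using integral_has_real_derivative_atLeast[OF cont]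
      by (intro continuous_on_subset[OF DERIV_continuous_on, of "{0..}"]) auto
  qed
  also have "integral {0..x} ?g = integral {0..x} (f_nu k A \<nu>) - W x"
    unfolding W_def using G_integrable[of 0 x]
    by (intro Henstock_Kurzweil_Integration.integral_diff
        integrable_continuous_real[OF continuous_on_subset[OF continuous_on_f_nu]]) auto
  finally show ?thesis
    by simp
qed

text \<open>
  Strictness comes from \<open>n\<close> in place of \<open>n - 1\<close> in \<open>\<kappa>\<close>; it lets the test at the maximum point of
  \<open>u - w\<close> go through without perturbing \<open>w\<close>.
\<close>

lemma barrier:
  defines "w \<equiv> \<lambda>m x. m + W (height N (\<gamma> R) x)"
  shows barrier_C2: "C2_on (half_space N) (w m)"
    and barrier_sym: "x \<in> half_space N \<Longrightarrow> sym_mat (hessian (w m) x)"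
    and barrier_strict: "x \<in> D_region N \<gamma> R \<Longrightarrow> 0 < F x 0 (grad (w m) x) (hessian (w m) x)"
proof -
  define g where "g = \<gamma> R"
  define G' where "G' = profile_deriv k B \<nu> \<kappa>"
  have g: "g > 0"
    unfolding g_def by (rule \<gamma>_pos[OF R])
  have w: "w m = (\<lambda>x. (\<lambda>r. m + W (r - g)) (norm (x - cen N g)))"
    by (simp add: w_def height_def g_def)
  have 1: "((\<lambda>r. m + W (r - g)) has_real_derivative G (r - g)) (at r)" if "r > g" for r
    using that by (auto intro!: derivative_eq_intros DERIV_chain2[OF W_deriv, THEN DERIV_cong])
  have 2: "((\<lambda>r. G (r - g)) has_real_derivative G' (r - g)) (at r)" if "r > g" for r
    unfolding G_def G'_def using that
    by (intro DERIV_chain2[OF profile_has_derivative[OF prof], THEN DERIV_cong])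
      (auto intro!: derivative_eq_intros)
  have 3: "continuous_on {g<..} (\<lambda>r. G' (r - g))"
    by (rule continuous_on_compose2[OF continuous_on_profile_deriv[OF prof, folded G'_def]])
      (auto intro!: continuous_intros)
  \<comment> \<open>The half space avoids the closed ball of radius \<open>g\<close> about the
    centre, so the radial calculus applies with \<open>\<rho> = g\<close>.\<close>
  have sub: "g < norm (x - cen N g)" if "x \<in> half_space N" for x
    using component_le_height[of x N g] that by (simp add: half_space_def height_def)
  show "C2_on (half_space N) (w m)"
    unfolding w using radial_C2_on[OF less_imp_le[OF g] 1 2 3] by (rule C2_on_subset) (use sub in auto)
  have hess: "hessian (w m) x = (G (height N g x) / norm (x - cen N g)) *\<^sub>R (mat 1 - outer (sgn (x - cen N g)))
      + G' (height N g x) *\<^sub>R outer (sgn (x - cen N g))" if "x \<in> half_space N" for x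
    unfolding w height_def by (rule radial_hessian[OF less_imp_le[OF g] 1 2 sub[OF that]])
  show sym: "sym_mat (hessian (w m) x)" if "x \<in> half_space N" for x
    unfolding hess[OF that]
    using sym_mat_diff[OF sym_mat_scaleR sym_mat_scaleR, OF sym_mat_diff, OF sym_mat_one sym_mat_outer sym_mat_outer,
        of _ "sgn (x - cen N g)" "- G' (height N g x)" "sgn (x - cen N g)"] by simp
  show "0 < F x 0 (grad (w m) x) (hessian (w m) x)" if x: "x \<in> D_region N \<gamma> R"
  proof -
    define s where "s = height N g x"
    define r where "r = norm (x - cen N g)"
    define e where "e = sgn (x - cen N g)"
    have xN: "x $ N > 0" "s < R" and xh: "x \<in> half_space N"
      using x by (auto simp: D_region_eq[where R=R and \<gamma>=\<gamma>, OF radius_nonneg[OF R]] s_def g_def half_space_def)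
    have s: "x $ N \<le> s" "s \<le> norm x" "0 < s"
      using component_le_height[of x N g] height_le_norm[of g N x] g xN by (auto simp: s_def)
    have r: "r > g" "r > 0"
      using sub[OF xh] g by (auto simp: r_def)
    have e: "norm e = 1"
      using r by (auto simp: e_def norm_sgn r_def)
    then have ee: "e \<bullet> e = 1"
      by (simp add: norm_eq_1)
    have B: "B s > 0" "A s \<le> B s"
      using B_pos A_le_B s by auto
    have Gk: "0 \<le> B s * G s powr k"
      using B by simp
    have G'_le: "G' s \<le> - \<kappa> * B s * G s - B s * G s powr k"
      unfolding G_def G'_def by (rule profile_deriv_le[OF prof]) (use s in auto)
    moreover have "- \<kappa> * B s * G s \<le> 0"
      using kappa_pos B G_pos[of s] by simp
    \<comment> \<open>The sign decides the splitting of the Hessian: its tangential part is the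
      positive part and its radial part the negative one.\<close>
    ultimately have G'_neg: "G' s \<le> 0"
      using Gk by linarith
    have hx: "hessian (w m) x = (G s / r) *\<^sub>R (mat 1 - outer e) - (- G' s) *\<^sub>R outer e"
      unfolding hess[OF xh] by (simp add: s_def r_def e_def)
    have "grad (w m) x = G s *\<^sub>R e"
      unfolding w e_def s_def height_def by (rule radial_grad[OF less_imp_le[OF g] 1 2 sub[OF xh]])
    then have gx: "norm (grad (w m) x) = G s"
      using e G_pos[of s] by simp
    have "pos_neg_parts (hessian (w m) x) ((G s / r) *\<^sub>R (mat 1 - outer e)) ((- G' s) *\<^sub>R outer e)"
      unfolding hx by (rule pos_neg_parts_radial[OF e]) (use G_pos[of s] r G'_neg in auto)
    from F_bound[OF _ sym[OF xh] this, where p = "grad (w m) x"]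
    have "- F x 0 (grad (w m) x) (hessian (w m) x)
      \<le> C (norm x) * G s powr k + Lam (x $ N) * trace ((G s / r) *\<^sub>R (mat 1 - outer e))
         - lam (x $ N) * trace ((- G' s) *\<^sub>R outer e)"
      using xN gx by simp
    also have "trace ((G s / r) *\<^sub>R (mat 1 - outer e)) = G s / r * (CARD('n) - 1)"
      using trace_sub[of "mat 1" "outer e"]
      by (simp add: trace_scaleR trace_I trace_outer ee)
    also have "trace ((- G' s) *\<^sub>R outer e) = - G' s"
      unfolding trace_scaleR trace_outer ee by simp
    also have "C (norm x) * G s powr k + Lam (x $ N) * (G s / r * (CARD('n) - 1)) - lam (x $ N) * - G' s
        \<le> C s * G s powr k + Lam R * (G s / g * (CARD('n) - 1)) + lam s * G' s"
    \<comment> \<open>All coefficients are moved to \<open>s\<close> or \<open>R\<close> in the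
      unfavourable direction, using \<open>x $ N \<le> s \<le> norm x\<close>, \<open>s < R\<close>,
      \<open>r > g\<close> and \<open>G' s \<le> 0\<close>.\<close>
    proof -
      have "C (norm x) * G s powr k \<le> C s * G s powr k"
        using C_antimono s by (intro mult_right_mono) auto
      moreover have "Lam (x $ N) * (G s / r * (CARD('n) - 1)) \<le> Lam R * (G s / g * (CARD('n) - 1))"
        using Lam_le[of "x $ N" R] Lam_pos[of R] xN s G_pos[of s] r g R
        by (intro mult_mono mult_right_mono divide_left_mono) auto
      moreover have "lam (x $ N) * G' s \<le> lam s * G' s"
        using lam_antimono[of "x $ N" s] xN s G'_neg by (intro mult_right_mono_neg) auto
      ultimately show ?thesis
        by linarith
    qed
    \<comment> \<open>Back from \<open>B\<close> to \<open>A\<close>: since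
      \<open>lam s * A s = C s\<close>, the nonlinear term then cancels the gradient term
      exactly.\<close>
    also have "lam s * G' s \<le> lam s * (- \<kappa> * A s * G s - A s * G s powr k)"
    proof (rule mult_left_mono)
      have "\<kappa> * A s * G s \<le> \<kappa> * B s * G s" "A s * G s powr k \<le> B s * G s powr k"
        using B kappa_pos G_pos[of s] by (auto intro!: mult_right_mono)
      then show "G' s \<le> - \<kappa> * A s * G s - A s * G s powr k"
        using G'_le by linarith
    qed (use lam_pos[of s] s in auto)
    also have "lam s * (- \<kappa> * A s * G s - A s * G s powr k) = - \<kappa> * C s * G s - C s * G s powr k"
    proof -
      have "C s = lam s * A s"
        using A_eq[of s] lam_pos[of s] s by simp
      then show ?thesis
        by (simp add: algebra_simps)
    qed
    finally have "- F x 0 (grad (w m) x) (hessian (w m) x)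
        \<le> G s * (Lam R / g * (CARD('n) - 1) - \<kappa> * C s)"
      by (simp add: algebra_simps)
    also have "\<dots> < 0"
    \<comment> \<open>The bound on \<open>\<gamma>\<close> turns the curvature coefficient into at
      most \<open>c * C R / I\<close> times \<open>n - 1\<close>, while
      \<open>\<kappa> * C s\<close> is at least \<open>n\<close> times
      \<open>c * C R / I\<close>.\<close>
    proof (rule mult_pos_neg[OF G_pos])
      define I where "I = integral {0..R} A"
      have I: "I > 0"
        unfolding I_def by (rule integral_A_pos[OF R])
      have CR: "C R > 0" "C R \<le> C s"
        using C_pos[of R] C_antimono[of s R] R xN s by auto
      have "Lam R / g \<le> c * C R / I"
        using \<gamma>_bound[OF R, folded I_def g_def] I CR g by (simp add: field_simps)
      then have "Lam R / g * (CARD('n) - 1) \<le> c * C R / I * (CARD('n) - 1)"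
        by (intro mult_right_mono) auto
      also have "\<dots> < c * C R / I * CARD('n)"
        using c_pos I CR by (intro mult_strict_left_mono) auto
      also have "\<dots> = \<kappa> * C R"
        by (simp add: \<kappa>_def I_def)
      also have "\<dots> \<le> \<kappa> * C s"
        using kappa_pos CR by (intro mult_left_mono) auto
      finally show "Lam R / g * (CARD('n) - 1) - \<kappa> * C s < 0"
        by simp
    qed
    finally show ?thesis
      by simp
  qed
qed

text \<open>On the cap the height is \<open>R\<close>, so the barrier equals \<open>m + W R\<close>,
  which bounds \<open>u\<close> there by hypothesis. Inside \<open>D(R)\<close> the comparison
  principle applies.\<close>

lemma u_le_barrier:
  assumes m: "m \<ge> 0" and M: "M_sup N \<gamma> u R \<le> ereal (m + W R)" and x: "x \<in> D_region N \<gamma> R"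
  shows "u x \<le> m + W (height N (\<gamma> R) x)"
proof (rule viscosity_comparison[OF sub ell open_half_space _ _ _ bdry barrier_C2 _ _ _ _ _ x])
  note D = radius_nonneg[OF R]
  show "open (D_region N \<gamma> R)" "bounded (D_region N \<gamma> R)"
    by (rule open_D_region[where R=R and \<gamma>=\<gamma>, OF D] bounded_D_region[where R=R and \<gamma>=\<gamma>, OF D])+
  show D_half: "D_region N \<gamma> R \<subseteq> half_space N"
    by (auto simp: D_region_def)
  have cl: "0 \<le> height N (\<gamma> R) y" if "y \<in> closure (D_region N \<gamma> R)" for y
    using closure_D_region[where R=R and \<gamma>=\<gamma>, OF D] component_le_height[of y N "\<gamma> R"] that by force
  show "continuous_on (closure (D_region N \<gamma> R)) (\<lambda>x. m + W (height N (\<gamma> R) x))"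
    by (intro continuous_intros continuous_on_compose2[OF W_cont]) (use cl in auto)
  show "0 \<le> m + W (height N (\<gamma> R) y)" for y
    using m W_nonneg by simp
  show "sym_mat (hessian (\<lambda>x. m + W (height N (\<gamma> R) x)) y)" if "y \<in> D_region N \<gamma> R" for y
    using barrier_sym D_half that by blast
  show "0 < F y 0 (grad (\<lambda>x. m + W (height N (\<gamma> R) x)) y) (hessian (\<lambda>x. m + W (height N (\<gamma> R) x)) y)"
    if "y \<in> D_region N \<gamma> R" for y
    by (rule barrier_strict[OF that])
  show "u y \<le> m + W (height N (\<gamma> R) y)"
    if "y \<in> frontier (D_region N \<gamma> R)" "y \<in> half_space N" for y
    using R that(1)
  proof (cases rule: frontier_D_region_cases)
    case cap
    have "ereal (u y) \<le> M_sup N \<gamma> u R"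
      unfolding M_sup_def cap(3)[symmetric] using that(1) by (rule SUP_upper)
    then have "ereal (u y) \<le> ereal (m + W R)"
      using M by (rule order_trans)
    then show ?thesis
      using cap by simp
  qed (use that in auto)
qed

lemma M_sup_ge:
  assumes "xbar $ N < R"
  shows "ereal (W R) \<le> M_sup N \<gamma> u R"
proof (rule ccontr)
  assume "\<not> ?thesis"
  \<comment> \<open>The negated claim is the premise of the comparison with \<open>m = 0\<close>;
    since \<open>xbar $ N < R\<close>, the point \<open>xbar\<close> lies in
    \<open>D(R)\<close>.\<close>
  then have M: "M_sup N \<gamma> u R \<le> ereal (0 + W R)"
    by simp
  have pos: "xbar $ N > 0"
    using xbar_in by (simp add: half_space_def)
  have h: "height N (\<gamma> R) xbar = xbar $ N"
    by (rule height_axis[OF xbar_axis]) (use pos \<gamma>_pos[OF R] in auto)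
  have "u xbar \<le> W (xbar $ N)"
    using u_le_barrier[OF order_refl M, of xbar] h pos assms by (simp add: D_region_eq[where R=R and \<gamma>=\<gamma>, OF radius_nonneg[OF R]])
  then show False
    using W_less_integral_f_nu[OF pos] u_xbar by simp
qed

lemma M_lower_deriv_ge:
  assumes "xbar $ N < R"
  shows "ereal (G R) \<le> M_lower_deriv N \<gamma> u R"
proof -
  obtain b where "M_sup N \<gamma> u R \<le> ereal b"
    using M_sup_bounded_above[OF R] by blast
  with M_sup_ge[OF assms] obtain M where M: "M_sup N \<gamma> u R = ereal M" and MW: "W R \<le> M"
    by (cases "M_sup N \<gamma> u R") auto
  define m where "m = M - W R"
  have m: "m \<ge> 0" "M_sup N \<gamma> u R \<le> ereal (m + W R)"
    using MW M by (auto simp: m_def)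
  \<comment> \<open>The bound holds for every quotient with \<open>0 < h < R\<close>, so it passes
    directly to the lower limit.\<close>
  have bound: "ereal (G R) \<le> (M_sup N \<gamma> u R - M_sup N \<gamma> u (R - h)) / ereal h" if h: "0 < h" "h < R" for h
  proof -
    have Rh: "R - h > 0"
      using h by simp
    have "M_sup N \<gamma> u (R - h) \<le> ereal (m + W (R - h))"
      unfolding M_sup_def
    proof (rule SUP_least)
      fix y assume "y \<in> frontier (D_region N \<gamma> (R - h))"
      with Rh show "upper_ext (half_space N) u y \<le> ereal (m + W (R - h))"
      proof (cases rule: frontier_D_region_cases)
        case cap
        \<comment> \<open>As \<open>\<gamma>\<close> is nondecreasing, the cap of the smaller
          region, measured from the centre belonging to \<open>R\<close>, has height at most
          \<open>R - h\<close>. It therefore lies in \<open>D(R)\<close>, where the barrier controls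
          \<open>u\<close>.\<close>
        have "\<gamma> (R - h) \<le> \<gamma> R"
          using \<gamma>_mono h Rh by (auto simp: mono_on_def)
        then have le: "height N (\<gamma> R) y \<le> R - h"
          using height_antimono[of "\<gamma> (R - h)" "\<gamma> R" N y] cap by simp
        have "0 < y $ N"
          using cap by (simp add: half_space_def)
        then have "u y \<le> m + W (height N (\<gamma> R) y)" "0 \<le> height N (\<gamma> R) y"
          using le h component_le_height[of y N "\<gamma> R"]
          by (auto intro!: u_le_barrier[OF m] simp: D_region_eq[where R=R and \<gamma>=\<gamma>, OF radius_nonneg[OF R]])
        then show ?thesis
          using W_mono[OF _ le] cap by simp
      next
        case flat
        have "(0::ereal) \<le> ereal (m + W (R - h))"
          using m W_nonneg by simp
        with flat show ?thesis
          by (metis order_trans)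
      qed
    qed
    then have "ereal M - ereal (m + W (R - h)) \<le> M_sup N \<gamma> u R - M_sup N \<gamma> u (R - h)"
      unfolding M by (intro ereal_minus_mono) auto
    \<comment> \<open>By the choice of \<open>m\<close> the right side is
      \<open>W R - W (R - h)\<close>.\<close>
    moreover have "h * G R \<le> M - (m + W (R - h))"
      using W_diff_ge[of "R - h" R] h by (simp add: m_def)
    then have "ereal (G R * h) \<le> ereal M - ereal (m + W (R - h))"
      by (simp add: mult.commute)
    ultimately have "ereal (G R * h) \<le> M_sup N \<gamma> u R - M_sup N \<gamma> u (R - h)"
      by (rule order_trans[rotated])
    then show ?thesis
      using h by (simp add: ereal_le_divide_pos mult.commute)
  qed
  have "eventually (\<lambda>h. 0 < h \<and> h < R) (at_right 0)"
    using R by (auto simp: eventually_at_right intro!: exI[of _ R])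
  then show ?thesis
    unfolding M_lower_deriv_def by (intro Liminf_bounded) (auto elim!: eventually_mono intro: bound)
qed

text \<open>The integral of \<open>A\<close> in the denominator of \<open>\<kappa>\<close> cancels,
  since the integral of \<open>B\<close> is at most twice as large; the exponent is at most
  \<open>2 * n * c\<close> at every radius.\<close>

lemma G_ge:
  assumes int_B: "integral {0..R} B \<le> integral {0..R} A + min 1 (integral {0..R} A)"
    and q: "q * f_nu k A \<nu> R \<le> f_nu k B \<nu> R"
  shows "exp (- (2 * real CARD('n) * c)) * q * f_nu k A \<nu> R \<le> G R"
proof -
  define I where "I = integral {0..R} A"
  have I: "I > 0"
    unfolding I_def by (rule integral_A_pos[OF R])
  have "\<kappa> * integral {0..R} B \<le> \<kappa> * (2 * I)"
    using int_B kappa_pos by (intro mult_left_mono) (auto simp: I_def)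
  also have "\<dots> = 2 * real CARD('n) * c"
    using I by (simp add: \<kappa>_def I_def)
  finally have "exp (- (2 * real CARD('n) * c)) \<le> exp (- \<kappa> * integral {0..R} B)"
    by simp
  moreover have "f_nu k B \<nu> R \<ge> 0"
    unfolding f_nu_eq_decay using decay_pos[OF k \<nu> order_trans[OF integral_A_nonneg integral_A_le_B]]
    by (rule less_imp_le)
  ultimately have "exp (- (2 * real CARD('n) * c)) * f_nu k B \<nu> R \<le> G R"
    unfolding G_def profile_def by (rule mult_right_mono)
  moreover have "exp (- (2 * real CARD('n) * c)) * (q * f_nu k A \<nu> R) \<le> exp (- (2 * real CARD('n) * c)) * f_nu k B \<nu> R"
    using q by (intro mult_left_mono) auto
  ultimately show ?thesis
    unfolding mult.assoc by (rule order_trans[rotated])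
qed

end

text \<open>The majorant \<open>B\<close> and with it the barrier are chosen anew for each
  \<open>R\<close>; the constants \<open>q\<close> and \<open>c\<close>, and hence \<open>d\<close>,
  do not depend on \<open>R\<close>.\<close>

lemma M_lower_deriv_ratio_bounded_below:
  obtains d where "d > 0" "\<And>R. R > xbar $ N \<Longrightarrow> ereal d \<le> M_lower_deriv N \<gamma> u R / ereal (f_nu k A \<nu> R)"
proof -
  obtain q where q: "q > 0"
    "\<And>\<nu> I J. \<nu> > 0 \<Longrightarrow> I \<ge> 0 \<Longrightarrow> J \<ge> 0 \<Longrightarrow> J \<le> I + min 1 I \<Longrightarrow> q * decay k \<nu> I \<le> decay k \<nu> J"
    using decay_lower_bound[OF k] by blast
  let ?d = "exp (- (2 * real CARD('n) * c)) * q"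
  have "ereal ?d \<le> M_lower_deriv N \<gamma> u R / ereal (f_nu k A \<nu> R)" if "R > xbar $ N" for R
  proof -
    have R: "R > 0"
      using xbar_in that by (simp add: half_space_def)
    \<comment> \<open>The excess \<open>min 1 (integral {0..R} A)\<close> is the one allowed by
      \<open>decay_lower_bound\<close>, and its second entry also bounds the damping.\<close>
    obtain B where B: "continuous_on {0..} B" "\<And>s. s \<ge> 0 \<Longrightarrow> C s * (1 / lam s) \<le> B s"
      and int_B: "integral {0..R} B \<le> integral {0..R} (\<lambda>s. C s * (1 / lam s)) + min 1 (integral {0..R} A)"
      using continuous_majorant[OF C_cont C_anti _ mono_inverse_lam, of R "min 1 (integral {0..R} A)"]
        C_pos lam_pos integral_A_pos[OF R] R by (auto simp: less_imp_le)
    have A_le_B: "A s \<le> B s" if "s \<ge> 0" for s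
      using B(2)[OF that] A_eq[OF that] by simp
    have "integral {0..R} (\<lambda>s. C s * (1 / lam s)) = integral {0..R} A"
      by (rule Henstock_Kurzweil_Integration.integral_cong) (simp add: A_eq)
    with int_B have int_B: "integral {0..R} B \<le> integral {0..R} A + min 1 (integral {0..R} A)"
      by simp
    have "q * f_nu k A \<nu> R \<le> f_nu k B \<nu> R"
      unfolding f_nu_eq_decay
      using order_trans[OF integral_A_nonneg integral_A_le_B[OF R B(1) A_le_B]]
      by (intro q(2) \<nu> integral_A_nonneg int_B) auto
    from G_ge[OF R B(1) A_le_B int_B this] M_lower_deriv_ge[OF R B(1) A_le_B that]
    have "ereal (?d * f_nu k A \<nu> R) \<le> M_lower_deriv N \<gamma> u R"
      by (meson ereal_less_eq(3) order_trans)
    then show ?thesis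
      using f_nu_pos[of R] by (simp add: ereal_le_divide_pos mult.commute)
  qed
  then show thesis
    using that[of ?d] q(1) by simp
qed

end

theorem mainTheorem6:
  fixes N :: "'n::finite"
    and k \<nu> :: real
    and F :: "real^'n \<Rightarrow> real \<Rightarrow> real^'n \<Rightarrow> real^'n^'n \<Rightarrow> real"
    and C lam Lam A \<gamma> :: "real \<Rightarrow> real"
    and u :: "real^'n \<Rightarrow> real"
    and xbar :: "real^'n"
  assumes k: "k \<ge> 1"
    and ell: "degenerate_elliptic F"
    and C_pos: "\<And>t. t \<ge> 0 \<Longrightarrow> C t > 0"
    and lam_pos: "\<And>t. t \<ge> 0 \<Longrightarrow> lam t > 0"
    and Lam_pos: "\<And>t. t \<ge> 0 \<Longrightarrow> Lam t > 0"
    and C_cont: "continuous_on {0..} C"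
    and C_anti: "antimono_on {0..} C"
    and lam_anti: "antimono_on {0..} lam"
    and Lam_mono: "mono_on {0..} Lam"
    and F_bound: "\<And>x p X P Q. x $ N \<ge> 0 \<Longrightarrow> sym_mat X \<Longrightarrow> pos_neg_parts X P Q \<Longrightarrow>
        - F x 0 p X \<le> C (norm x) * norm p powr k + Lam (x $ N) * trace P - lam (x $ N) * trace Q"
    and A_eq: "\<And>t. t \<ge> 0 \<Longrightarrow> A t = C t / lam t"
    and \<gamma>_pos: "\<And>R. R > 0 \<Longrightarrow> \<gamma> R > 0"
    and \<gamma>_mono: "mono_on {0<..} \<gamma>"
    and \<gamma>_bound: "\<exists>c>0. \<forall>R>0. Lam R / C R * integral {0..R} A \<le> c * \<gamma> R"
    and sub: "viscosity_subsolution F (half_space N) u"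
    and bdry: "\<And>y. y \<in> frontier (half_space N) \<Longrightarrow>
        Limsup (at y within half_space N) (\<lambda>x. ereal (u x)) \<le> 0"
    and \<nu>: "\<nu> > 0"
    and xbar_in: "xbar \<in> half_space N"
    and xbar_axis: "\<And>i. i \<noteq> N \<Longrightarrow> xbar $ i = 0"
    and u_xbar: "u xbar \<ge> integral {0..xbar $ N} (f_nu k A \<nu>)"
  shows "Liminf at_top (\<lambda>R. M_lower_deriv N \<gamma> u R / ereal (f_nu k A \<nu> R)) > 0"
proof -
  obtain c where "c > 0" "\<forall>R>0. Lam R / C R * integral {0..R} A \<le> c * \<gamma> R"
    using \<gamma>_bound by blast
  then interpret growth_problem N k \<nu> c F C lam Lam A \<gamma> u xbar
    using assms by unfold_locales auto
  obtain d where d: "d > 0"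
    "\<And>R. R > xbar $ N \<Longrightarrow> ereal d \<le> M_lower_deriv N \<gamma> u R / ereal (f_nu k A \<nu> R)"
    using M_lower_deriv_ratio_bounded_below by blast
  have "0 < ereal d"
    using d(1) by simp
  also have "\<dots> \<le> Liminf at_top (\<lambda>R. M_lower_deriv N \<gamma> u R / ereal (f_nu k A \<nu> R))"
    by (intro Liminf_bounded eventually_mono[OF eventually_gt_at_top[of "xbar $ N"]] d(2))
  finally show ?thesis .
qed

end
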